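(* Fix $a\in(0,1)$ and let $P_n^a\subset\mathbb{R}^{2^n}$ be the basic polytopes defined below; let $d=2^n$ denote the dimension, and for a $d$-dimensional polytope $P$ let $f_k(P)$ denote the number of $k$-dimensional faces of $P$. Let $\delta\in(0,1)$. 1. If $a\in\mathbb{Q}$, then there are constants $c,C>0$ depending only on $a$ and $\delta$ such that for all sufficiently large $n$, \[ c\,d^{a+\delta(1-a)} \le \log f_{\lfloor d^{\delta}\rfloor}(P_n^a) \le C\,d^{a+\delta(1-a)}. \] 2. If $a\notin\mathbb{Q}$, then \[ \log f_{\lfloor d^{\delta}\rfloor}(P_n^a) = d^{\,a+\delta(1-a)+\varepsilon_d}, \] where $\varepsilon_d\to 0$ as $d\to\infty$; concretely $|\varepsilon_d| = O\big(1/\sqrt{\log d}\big)$, with implied constant depending only on $a$ and $\delta$.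
   Context: Basic polytopes: fix $a\in(0,1)$ and let $A_a=\{\lfloor n/a\rfloor : n\in\mathbb{N}\}$ (a set of density $a$ in $\mathbb{N}$). Define $P_0^a=[-1,1]\subset\mathbb{R}$, and inductively, given $P_{n-1}^a\subset\mathbb{R}^{2^{n-1}}$, orthogonally decompose $\mathbb{R}^{2^n}=\mathbb{R}^{2^{n-1}}\times\mathbb{R}^{2^{n-1}}$, place one copy of $P_{n-1}^a$ in each factor (i.e. $P_{n-1}^a\times\{0\}$ and $\{0\}\times P_{n-1}^a$), and set $P_n^a = P_{n-1}^a\times P_{n-1}^a$ (Cartesian product) if $n\in A_a$, and $P_n^a=\mathrm{conv}\big((P_{n-1}^a\times\{0\})\cup(\{0\}\times P_{n-1}^a)\big)$ if $n\notin A_a$. Thus $P_n^a$ is a $2^n$-dimensional polytope. *)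

theory Defs
  imports "HOL-Analysis.Analysis" "HOL-Analysis.Finite_Function_Topology" "HOL-Library.Landau_Symbols"
begin

text \<open>
  The dimension \<open>2 ^ n\<close> varies inside the statement, so \<open>\<real>\<^sup>d\<close> is represented as the subspace of
  those vectors of \<open>nat \<Rightarrow>\<^sub>0 real\<close> whose coordinates with index \<open>\<ge> d\<close> vanish. Convexity and faces are
  the library notions for real vector spaces.
\<close>

definition coord_space :: "nat \<Rightarrow> (nat \<Rightarrow>\<^sub>0 real) set" where
  "coord_space d = {x. Poly_Mapping.keys x \<subseteq> {..<d}}"

lemma coord_space_iff: "x \<in> coord_space d \<longleftrightarrow> (\<forall>i\<ge>d. Poly_Mapping.lookup x i = 0)"
  unfolding coord_space_def subset_iff lessThan_iff in_keys_iff mem_Collect_eq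
  by (meson not_le)

lift_definition shift_coords :: "nat \<Rightarrow> (nat \<Rightarrow>\<^sub>0 real) \<Rightarrow> (nat \<Rightarrow>\<^sub>0 real)"
  is "\<lambda>d x i. if i < d then 0 else x (i - d)"
proof -
  fix d :: nat and x :: "nat \<Rightarrow> real"
  assume "finite {i. x i \<noteq> 0}"
  then have "finite ((\<lambda>i. i + d) ` {i. x i \<noteq> 0})" by simp
  moreover have "{i. (if i < d then 0 else x (i - d)) \<noteq> 0} \<subseteq> (\<lambda>i. i + d) ` {i. x i \<noteq> 0}"
  proof
    fix i assume "i \<in> {i. (if i < d then 0 else x (i - d)) \<noteq> 0}"
    then have "i = (i - d) + d" and "i - d \<in> {i. x i \<noteq> 0}" by (auto split: if_splits)
    then show "i \<in> (\<lambda>i. i + d) ` {i. x i \<noteq> 0}" by blast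
  qed
  ultimately show "finite {i. (if i < d then 0 else x (i - d)) \<noteq> 0}"
    by (rule finite_subset[rotated])
qed

text \<open>
  For \<open>x\<close>, \<open>y\<close> in \<open>\<real>\<^sup>d\<close>, \<open>pair_coords d x y\<close> is the point \<open>(x, y)\<close> of
  \<open>\<real>\<^sup>d \<times> \<real>\<^sup>d = \<real>\<^bsup>2d\<^esup>\<close>: the first \<open>d\<close> coordinates are those of \<open>x\<close>, the next \<open>d\<close> those of \<open>y\<close>.
\<close>

definition pair_coords :: "nat \<Rightarrow> (nat \<Rightarrow>\<^sub>0 real) \<Rightarrow> (nat \<Rightarrow>\<^sub>0 real) \<Rightarrow> (nat \<Rightarrow>\<^sub>0 real)" where
  "pair_coords d x y = x + shift_coords d y"

lemma lookup_pair_coords: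
  assumes "x \<in> coord_space d"
  shows "Poly_Mapping.lookup (pair_coords d x y) i =
    (if i < d then Poly_Mapping.lookup x i else Poly_Mapping.lookup y (i - d))"
  using assms by (simp add: pair_coords_def lookup_add shift_coords.rep_eq coord_space_iff)

lemma pair_coords_in_coord_space:
  assumes "x \<in> coord_space d" "y \<in> coord_space d"
  shows "pair_coords d x y \<in> coord_space (2 * d)"
  using assms(2) by (simp add: coord_space_iff lookup_pair_coords[OF assms(1)])

text \<open>Whether \<open>0\<close> counts as a natural number here is immaterial: it only decides \<open>0 \<in> beatty_set a\<close>,
  which the construction of the polytopes never inspects.\<close>

definition beatty_set :: "real \<Rightarrow> nat set" where
  "beatty_set a = {nat \<lfloor>real m / a\<rfloor> | m :: nat. True}"

fun basic_polytope :: "real \<Rightarrow> nat \<Rightarrow> (nat \<Rightarrow>\<^sub>0 real) set" where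
  "basic_polytope a 0 = {Poly_Mapping.single 0 t | t. t \<in> {-1..1}}"
| "basic_polytope a (Suc n) =
    (if Suc n \<in> beatty_set a
     then {pair_coords (2 ^ n) x y | x y. x \<in> basic_polytope a n \<and> y \<in> basic_polytope a n}
     else convex hull
       ({pair_coords (2 ^ n) x 0 | x. x \<in> basic_polytope a n} \<union>
        {pair_coords (2 ^ n) 0 y | y. y \<in> basic_polytope a n}))"

lemma lookup_scaleR_poly_mapping:
  "Poly_Mapping.lookup (c *\<^sub>R x) i = c *\<^sub>R Poly_Mapping.lookup x i"
proof -
  have "{i. c *\<^sub>R Poly_Mapping.lookup x i \<noteq> 0} \<subseteq> Poly_Mapping.keys x"
    by (auto intro: in_keys_iff[THEN iffD2])
  then have "finite {i. c *\<^sub>R Poly_Mapping.lookup x i \<noteq> 0}"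
    by (rule finite_subset) simp
  then show ?thesis
    by (simp add: scaleR_poly_mapping_def Abs_poly_mapping_inverse)
qed

lemma subspace_coord_space: "subspace (coord_space d)"
  by (simp add: subspace_def coord_space_iff lookup_add lookup_scaleR_poly_mapping)

lemma basic_polytope_subset: "basic_polytope a n \<subseteq> coord_space (2 ^ n)"
proof (induction n)
  case 0
  show ?case by (auto simp: coord_space_iff lookup_single)
next
  case (Suc n)
  have 0: "0 \<in> coord_space (2 ^ n)" by (simp add: coord_space_iff)
  have P: "pair_coords (2 ^ n) x y \<in> coord_space (2 ^ Suc n)"
    if "x \<in> coord_space (2 ^ n)" "y \<in> coord_space (2 ^ n)" for x y
    using pair_coords_in_coord_space[OF that] by simp
  have "convex (coord_space (2 ^ Suc n))"
    by (rule subspace_imp_convex[OF subspace_coord_space])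
  then have "convex hull S \<subseteq> coord_space (2 ^ Suc n)" if "S \<subseteq> coord_space (2 ^ Suc n)" for S
    using that by (simp add: hull_minimal)
  moreover have "{pair_coords (2 ^ n) x 0 | x. x \<in> basic_polytope a n} \<union>
      {pair_coords (2 ^ n) 0 y | y. y \<in> basic_polytope a n} \<subseteq> coord_space (2 ^ Suc n)"
    using Suc P 0 by blast
  moreover have "{pair_coords (2 ^ n) x y | x y. x \<in> basic_polytope a n \<and> y \<in> basic_polytope a n}
      \<subseteq> coord_space (2 ^ Suc n)"
    using Suc P by blast
  ultimately show ?case by simp
qed

text \<open>
  The library's \<^const>\<open>aff_dim\<close> is restricted to Euclidean spaces. The following is its defining
  condition, stated for arbitrary real vector spaces; it excludes the empty set since \<open>k \<ge> 0\<close>.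
\<close>

definition has_aff_dim :: "'a::real_vector set \<Rightarrow> nat \<Rightarrow> bool" where
  "has_aff_dim S k \<longleftrightarrow>
    (\<exists>B. affine hull B = affine hull S \<and> \<not> affine_dependent B \<and> card B = k + 1)"

lemma has_aff_dim_iff_aff_dim:
  fixes S :: "'a::euclidean_space set"
  shows "has_aff_dim S k \<longleftrightarrow> aff_dim S = int k"
proof
  assume "has_aff_dim S k"
  then obtain B where "affine hull B = affine hull S" "\<not> affine_dependent B" "card B = k + 1"
    unfolding has_aff_dim_def by blast
  with aff_dim_unique[of B S] show "aff_dim S = int k" by simp
next
  assume *: "aff_dim S = int k"
  obtain B where "affine hull B = affine hull S" "\<not> affine_dependent B" "int (card B) = aff_dim S + 1"
    using aff_dim_basis_exists[of S] by metis
  with * have "card B = k + 1" by linarith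
  then show "has_aff_dim S k"
    unfolding has_aff_dim_def using \<open>affine hull B = affine hull S\<close> \<open>\<not> affine_dependent B\<close> by blast
qed

definition num_faces :: "nat \<Rightarrow> 'a::real_vector set \<Rightarrow> nat" where
  "num_faces k P = card {F. F face_of P \<and> has_aff_dim F k}"

end

theory Submission
  imports Defs
begin

text \<open>
  A nonempty face of a product is a product of nonempty faces. For symmetric summands, a proper face
  of a free sum is the join of two proper faces, either possibly empty, and joining nonempty faces
  adds one to the sum of their dimensions. So the face numbers obey recursive inequalities of
  convolution type: each step squares, or roughly preserves, the number of vertices.

  After \<open>l\<close> steps about \<open>a l\<close> products have occurred, and the logarithm of the vertex number has
  order \<open>2 powr (a l)\<close>; between consecutive products it grows only additively. View the polytope
  as \<open>2 ^ m\<close> copies of the one of level \<open>l = n - m\<close>, where \<open>2 ^ m\<close> is comparable to \<open>d powr \<delta>\<close>.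
  Choosing a vertex in each copy yields at least \<open>v ^ (2 ^ m)\<close> faces of dimension below \<open>2 ^ m\<close>,
  where \<open>v\<close> is the vertex number at level \<open>l\<close>. Conversely, at level \<open>l\<close> there are at most
  \<open>V ^ (k + 1)\<close> faces of dimension \<open>k\<close>, where \<open>ln V\<close> is of the same order as \<open>ln v\<close>, and
  \<open>m\<close> convolutions turn this into \<open>(4 V) ^ (2 ^ m) * (2 ^ m * V) ^ k\<close>.
  Both bounds have logarithm of order \<open>2 powr (\<delta> n + a (1 - \<delta>) n)\<close>, whether or not \<open>a\<close> is rational,
  so in the irrational case the error exponent is even \<open>O(1 / n)\<close>.
\<close>

section \<open>Affine dimension through linear dimension\<close>

text \<open>The direction space of an affine hull does not depend on the base point. One inclusion
  suffices, since the roles of \<open>a\<close> and \<open>b\<close> can be exchanged.\<close>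

lemma translated_span_affine_hull:
  fixes F :: "'a::real_vector set"
  assumes "a \<in> affine hull F" "b \<in> affine hull F"
  shows "span ((\<lambda>x. - b + x) ` F) \<subseteq> span ((\<lambda>x. - a + x) ` F)"
proof
  fix z assume z: "z \<in> span ((\<lambda>x. - b + x) ` F)"
  note A = affine_hull_span_gen[OF assms(1)] and B = affine_hull_span_gen[OF assms(2)]
  have "b + z \<in> affine hull F" unfolding B using z by blast
  then obtain w where w: "b + z = a + w" "w \<in> span ((\<lambda>x. - a + x) ` F)" unfolding A by blast
  obtain v where v: "b = a + v" "v \<in> span ((\<lambda>x. - a + x) ` F)" using assms(2) unfolding A by blast
  have "z = w - v" using w(1) v(1) by (simp add: algebra_simps)
  then show "z \<in> span ((\<lambda>x. - a + x) ` F)" using w v by (simp add: span_diff)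
qed

text \<open>Reduces affine dimension to linear dimension. The finite set \<open>E\<close> stands in
  for a finite-dimensional ambient space: it forces the bases to be finite, so that
  \<open>card\<close> counts them faithfully.\<close>

lemma has_aff_dim_iff_dim:
  fixes F :: "'a::real_vector set"
  assumes E: "finite E" "F \<subseteq> span E" and a: "a \<in> F"
  shows "has_aff_dim F k \<longleftrightarrow> dim ((\<lambda>x. - a + x) ` F) = k"
proof -
  let ?V = "(\<lambda>x. - a + x) ` F"
  have aF: "a \<in> affine hull F" using a by (rule hull_inc)
  have VE: "?V \<subseteq> span E"
    using E(2) a by (auto intro!: span_diff)
  obtain B where B: "B \<subseteq> ?V" "independent B" "?V \<subseteq> span B" "card B = dim ?V"
    by (rule basis_exists)
  have finB: "finite B"
    using independent_span_bound[OF E(1) B(2)] B(1) VE by auto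
  have spB: "span B = span ?V"
    using B by (metis span_eq span_superset subset_trans)
  show ?thesis
  proof
    assume "dim ?V = k"
    \<comment> \<open>A basis of the direction space, moved back to \<open>a\<close> and enlarged by
      \<open>a\<close> itself, is an affine basis; this is where the \<open>k + 1\<close> points
      come from.\<close>
    define C where "C = insert a ((\<lambda>x. a + x) ` B)"
    have B': "B = (\<lambda>x. - a + x) ` ((\<lambda>x. a + x) ` B)"
      by (simp add: image_image)
    have n0: "0 \<notin> B" using B(2) dependent_zero by blast
    then have na: "a \<notin> (\<lambda>x. a + x) ` B" by auto
    have "\<not> affine_dependent C"
      unfolding C_def affine_dependent_iff_dependent[OF na] using B' B(2) by simp
    moreover have "affine hull C = affine hull F"
      unfolding C_def affine_hull_insert_span_gen B'[symmetric] spB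
      using affine_hull_span_gen[OF aF] by simp
    moreover have "card C = k + 1"
      unfolding C_def using na finB \<open>dim ?V = k\<close> B(4) by (simp add: card_image)
    ultimately show "has_aff_dim F k" unfolding has_aff_dim_def by blast
  next
    assume "has_aff_dim F k"
    then obtain C where C: "affine hull C = affine hull F" "\<not> affine_dependent C" "card C = k + 1"
      unfolding has_aff_dim_def by blast
    then obtain b where b: "b \<in> C" by fastforce
    \<comment> \<open>The points of \<open>C\<close> need not lie in \<open>F\<close>, so the
      direction space is first computed from \<open>b\<close> in the affine hull and then compared
      with the one based at \<open>a\<close>.\<close>
    define B0 where "B0 = (\<lambda>x. - b + x) ` (C - {b})"
    have ind: "independent B0"
      using C(2) unfolding B0_def affine_dependent_iff_dependent2[OF b] .
    have bF: "b \<in> affine hull F" using b C(1) hull_inc by metis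
    have "(\<lambda>x. b + x) ` span B0 = (\<lambda>x. b + x) ` span ((\<lambda>x. - b + x) ` F)"
      using affine_hull_span2[OF b] C(1) affine_hull_span_gen[OF bF] unfolding B0_def by simp
    then have "span B0 = span ((\<lambda>x. - b + x) ` F)"
      by (simp add: inj_image_eq_iff)
    also have "\<dots> = span ?V"
      using translated_span_affine_hull[OF aF bF] translated_span_affine_hull[OF bF aF] by blast
    finally have "dim ?V = card B0" by (rule dim_eq_card[OF _ ind])
    also have "card B0 = k"
      unfolding B0_def using C(3) b by (subst card_image) (auto simp: inj_on_def)
    finally show "dim ?V = k" .
  qed
qed

lemma has_aff_dim_imp_nonempty: "has_aff_dim F k \<Longrightarrow> F \<noteq> {}"
  unfolding has_aff_dim_def by force

text \<open>The union of bases of the two spans is independent: a vanishing combination equates a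
  vector of one span with a vector of the other, so both vanish.\<close>

lemma dim_Un_direct:
  fixes V W :: "'a::real_vector set"
  assumes E: "finite E" "V \<subseteq> span E" "W \<subseteq> span E" and VW: "span V \<inter> span W \<subseteq> {0}"
  shows "dim (V \<union> W) = dim V + dim W"
proof -
  obtain B where B: "B \<subseteq> V" "independent B" "V \<subseteq> span B" "card B = dim V"
    by (rule basis_exists)
  obtain C where C: "C \<subseteq> W" "independent C" "W \<subseteq> span C" "card C = dim W"
    by (rule basis_exists)
  have fin: "finite B" "finite C"
    using independent_span_bound[OF E(1) B(2)] independent_span_bound[OF E(1) C(2)] B(1) C(1) E
    by auto
  have BC: "span B \<inter> span C \<subseteq> {0}"
    using VW span_mono[OF B(1)] span_mono[OF C(1)] by blast
  have disj: "B \<inter> C = {}"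
    using BC span_superset[of B] span_superset[of C] B(2) dependent_zero by blast
  have "independent (B \<union> C)"
  proof (rule independent_if_scalars_zero)
    show "finite (B \<union> C)" using fin by simp
    fix f x assume s: "(\<Sum>x\<in>B \<union> C. f x *\<^sub>R x) = 0" and x: "x \<in> B \<union> C"
    have "(\<Sum>x\<in>B. f x *\<^sub>R x) + (\<Sum>x\<in>C. f x *\<^sub>R x) = 0"
      using s sum.union_disjoint[OF fin disj, of "\<lambda>x. f x *\<^sub>R x"] by simp
    then have eq: "(\<Sum>x\<in>B. f x *\<^sub>R x) = - (\<Sum>x\<in>C. f x *\<^sub>R x)"
      by (simp add: eq_neg_iff_add_eq_0)
    have inB: "(\<Sum>x\<in>B. f x *\<^sub>R x) \<in> span B" by (intro span_sum span_scale span_base)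
    have inC: "(\<Sum>x\<in>C. f x *\<^sub>R x) \<in> span C" by (intro span_sum span_scale span_base)
    have zB: "(\<Sum>x\<in>B. f x *\<^sub>R x) = 0"
      using BC inB span_neg[OF inC] eq by auto
    then have zC: "(\<Sum>x\<in>C. f x *\<^sub>R x) = 0" using eq by simp
    show "f x = 0"
      using x independentD[OF B(2) fin(1) subset_refl zB] independentD[OF C(2) fin(2) subset_refl zC]
      by blast
  qed
  moreover have "span (B \<union> C) = span (V \<union> W)"
  proof
    show "span (B \<union> C) \<subseteq> span (V \<union> W)" using B(1) C(1) by (intro span_mono) blast
    have "V \<union> W \<subseteq> span (B \<union> C)"
      using B(3) C(3) span_mono[of B "B \<union> C"] span_mono[of C "B \<union> C"] by blast
    then show "span (V \<union> W) \<subseteq> span (B \<union> C)" by (simp add: span_minimal)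
  qed
  ultimately have "dim (V \<union> W) = card (B \<union> C)" by (intro dim_eq_card)
  then show ?thesis using B(4) C(4) card_Un_disjoint[OF fin disj] by simp
qed

text \<open>If the base point \<open>a\<close> lay in the direction space, then
  \<open>a + (- a) = 0\<close> would lie in the affine hull. So \<open>a\<close> adds exactly one
  dimension to the direction space. This is the source of the extra dimension of a join.\<close>

lemma has_aff_dim_iff_dim_Suc:
  fixes F :: "'a::real_vector set"
  assumes E: "finite E" "F \<subseteq> span E" and "F \<noteq> {}" and n0: "0 \<notin> affine hull F"
  shows "has_aff_dim F k \<longleftrightarrow> dim F = Suc k"
proof -
  obtain a where a: "a \<in> F" using assms(3) by blast
  let ?V = "(\<lambda>x. - a + x) ` F"
  have aF: "a \<in> affine hull F" using a by (rule hull_inc)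
  have nV: "a \<notin> span ?V"
  proof
    assume "a \<in> span ?V"
    then have "a + (- a) \<in> affine hull F"
      unfolding affine_hull_span_gen[OF aF] by (intro imageI span_neg)
    then show False using n0 by simp
  qed
  have VE: "?V \<subseteq> span E"
    using E(2) a by (auto intro!: span_diff)
  obtain B where B: "B \<subseteq> ?V" "independent B" "?V \<subseteq> span B" "card B = dim ?V"
    by (rule basis_exists)
  have finB: "finite B"
    using independent_span_bound[OF E(1) B(2)] B(1) VE by auto
  have spB: "span B = span ?V"
    using B by (metis span_eq span_superset subset_trans)
  have aB: "a \<notin> span B" using nV spB by simp
  then have "independent (insert a B)" using B(2) by (simp add: independent_insertI)
  moreover have "span (insert a B) = span F"
  proof
    have "?V \<subseteq> span F"
      using a by (auto intro: span_diff span_base)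
    then have "insert a B \<subseteq> span F"
      using a B(1) span_base by blast
    then show "span (insert a B) \<subseteq> span F" by (simp add: span_minimal)
    have "x \<in> span (insert a B)" if "x \<in> F" for x
    proof -
      have "- a + x \<in> span (insert a B)"
        using that B(3) span_mono[of B "insert a B"] by blast
      moreover have "a \<in> span (insert a B)" by (simp add: span_base)
      ultimately have "a + (- a + x) \<in> span (insert a B)" by (rule span_add[rotated])
      then show ?thesis by simp
    qed
    then show "span F \<subseteq> span (insert a B)" by (simp add: span_minimal subsetI)
  qed
  ultimately have "dim F = card (insert a B)" by (intro dim_eq_card)
  also have "\<dots> = Suc (dim ?V)"
    using aB finB B(4) span_base by (metis card_insert_disjoint)
  finally show ?thesis using has_aff_dim_iff_dim[OF E a] by simp
qed

section \<open>Faces of symmetric convex sets\<close>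

text \<open>The face condition in terms of weights. The degenerate cases \<open>d = 0\<close> and
  \<open>a = b\<close>, which open segments exclude, are included, so that later arguments may let
  weights vanish.\<close>

lemma face_of_convex_comb:
  assumes "F face_of S" "a \<in> S" "b \<in> S" "0 < c" "0 \<le> d" "c + d = 1" "c *\<^sub>R a + d *\<^sub>R b \<in> F"
  shows "a \<in> F"
proof (cases "d = 0 \<or> a = b")
  case True
  then show ?thesis using assms(6,7) by (auto simp flip: scaleR_add_left)
next
  case False
  have "c = 1 - d" using assms(6) by simp
  then have "c *\<^sub>R a + d *\<^sub>R b \<in> open_segment a b"
    unfolding in_segment using False assms(4,5) by (intro conjI exI[of _ d]) auto
  then show ?thesis using face_ofD[OF assms(1) _ assms(2,3,7)] by blast
qed

lemma face_ofI_convex_comb: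
  assumes "F \<subseteq> S" "convex F"
    and "\<And>a b u. \<lbrakk>a \<in> S; b \<in> S; 0 < u; u < 1; (1 - u) *\<^sub>R a + u *\<^sub>R b \<in> F\<rbrakk> \<Longrightarrow> a \<in> F \<and> b \<in> F"
  shows "F face_of S"
  unfolding face_of_def using assms by (auto simp: in_segment)

text \<open>The origin is the midpoint of \<open>x\<close> and \<open>- x\<close>, for every
  \<open>x\<close> in the symmetric set.\<close>

lemma face_of_symmetric_eq:
  assumes "F face_of S" "0 \<in> F" and "\<And>x. x \<in> S \<Longrightarrow> - x \<in> S"
  shows "F = S"
proof
  show "S \<subseteq> F"
  proof
    fix x assume x: "x \<in> S"
    show "x \<in> F"
      by (rule face_of_convex_comb[OF assms(1) x assms(3)[OF x], of "1/2" "1/2"]) (simp_all add: assms(2))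
  qed
qed (use assms(1) face_of_imp_subset in blast)

text \<open>Collect the positive and the nonpositive coefficients of an affine combination: with
  \<open>- t\<close> the sum of the latter, the former sum to \<open>1 + t\<close>, and each group,
  once normalised, is a convex combination.\<close>

lemma affine_hull_convex_diff:
  fixes F :: "'a::real_vector set"
  assumes "convex F" "z \<in> affine hull F"
  obtains p q t where "p \<in> F" "q \<in> F" "0 \<le> t" "z = (1 + t) *\<^sub>R p - t *\<^sub>R q"
proof -
  obtain S u where S: "finite S" "S \<noteq> {}" "S \<subseteq> F" "sum u S = 1" "(\<Sum>v\<in>S. u v *\<^sub>R v) = z"
    using assms(2) unfolding affine_hull_explicit by blast
  define A where "A = {v \<in> S. u v > 0}"
  define B where "B = {v \<in> S. u v \<le> 0}"
  define t where "t = - sum u B"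
  have AB: "S = A \<union> B" "A \<inter> B = {}" "finite A" "finite B"
    using S(1) by (auto simp: A_def B_def)
  have t0: "t \<ge> 0" by (auto simp: t_def B_def intro!: sum_nonpos)
  have sA: "sum u A = 1 + t"
    using S(4) sum.union_disjoint[OF AB(3,4,2), of u] AB(1) by (simp add: t_def)
  have z: "z = (\<Sum>v\<in>A. u v *\<^sub>R v) + (\<Sum>v\<in>B. u v *\<^sub>R v)"
    using S(5) sum.union_disjoint[OF AB(3,4,2), of "\<lambda>v. u v *\<^sub>R v"] AB(1) by simp
  define p where "p = (\<Sum>v\<in>A. (u v / (1 + t)) *\<^sub>R v)"
  have p: "p \<in> F"
    unfolding p_def using S(3) t0 sA
    by (intro convex_sum[OF AB(3) assms(1)]) (auto simp: A_def simp flip: sum_divide_distrib)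
  have pA: "(1 + t) *\<^sub>R p = (\<Sum>v\<in>A. u v *\<^sub>R v)"
    using t0 by (simp add: p_def scaleR_sum_right)
  show ?thesis
  proof (cases "t = 0")
    case True
    \<comment> \<open>Without negative coefficients the combination is already convex, and
      \<open>p\<close> serves as a default for \<open>q\<close>.\<close>
    then have "\<forall>v\<in>B. - u v = 0"
      using sum_nonneg_eq_0_iff[OF AB(4), of "\<lambda>v. - u v"] by (auto simp: t_def B_def sum_negf)
    then have "z = (1 + t) *\<^sub>R p - t *\<^sub>R p" using z pA True by simp
    then show ?thesis using that[OF p p t0] by blast
  next
    case False
    define q where "q = (\<Sum>v\<in>B. (- u v / t) *\<^sub>R v)"
    have q: "q \<in> F"
      unfolding q_def using S(3) t0 False
      by (intro convex_sum[OF AB(4) assms(1)])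
        (auto simp: B_def t_def sum_negf divide_nonpos_neg simp flip: sum_divide_distrib)
    have "t *\<^sub>R q = - (\<Sum>v\<in>B. u v *\<^sub>R v)"
      using False by (simp add: q_def scaleR_sum_right sum_negf)
    then show ?thesis using that[OF p q t0] z pA by simp
  qed
qed

text \<open>If \<open>0 = (1 + t) p - t q\<close> with \<open>p\<close>, \<open>q\<close> in the
  face, then \<open>p\<close> is a convex combination of \<open>0\<close> and \<open>q\<close> with
  positive weight on \<open>0\<close>, which pulls \<open>0\<close> into the face.\<close>

lemma zero_notin_affine_hull_face:
  fixes S :: "'a::real_vector set"
  assumes F: "F face_of S" and S: "0 \<in> S" and n0: "0 \<notin> F"
  shows "0 \<notin> affine hull F"
proof
  assume "0 \<in> affine hull F"
  moreover have "convex F" using F by (simp add: face_of_def)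
  ultimately obtain p q t where pq: "p \<in> F" "q \<in> F" "0 \<le> t" "0 = (1 + t) *\<^sub>R p - t *\<^sub>R q"
    using affine_hull_convex_diff by metis
  have "(1 + t) *\<^sub>R p = t *\<^sub>R q" using pq(4) by simp
  then have "(1 / (1 + t)) *\<^sub>R (1 + t) *\<^sub>R p = (1 / (1 + t)) *\<^sub>R (t *\<^sub>R q)"
    by simp
  then have "p = (1 / (1 + t)) *\<^sub>R (t *\<^sub>R q)"
    using pq(3) by simp
  then have p: "p = (1 / (1 + t)) *\<^sub>R 0 + (t / (1 + t)) *\<^sub>R q" by simp
  have "0 \<in> F"
    by (rule face_of_convex_comb[OF F S, of q "1/(1+t)" "t/(1+t)"])
      (use pq p F face_of_imp_subset in \<open>auto simp: field_simps\<close>)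
  then show False using n0 by blast
qed

text \<open>The point \<open>x\<close> is the weighted mean of \<open>x1\<close> and \<open>x2\<close>, and an arbitrary choice when both weights vanish.\<close>

lemma face_weighted_mean:
  assumes F: "F face_of S" and S: "convex S" and x: "x1 \<in> S" "x2 \<in> S" and w: "0 \<le> w1" "0 \<le> w2"
  obtains x where "x \<in> S" "(w1 + w2) *\<^sub>R x = w1 *\<^sub>R x1 + w2 *\<^sub>R x2"
    and "0 < w1 + w2 \<longrightarrow> (0 < w1 \<longrightarrow> x1 \<in> F) \<longrightarrow> (0 < w2 \<longrightarrow> x2 \<in> F) \<longrightarrow> x \<in> F"
    and "x \<in> F \<longrightarrow> 0 < w1 \<longrightarrow> x1 \<in> F" and "x \<in> F \<longrightarrow> 0 < w2 \<longrightarrow> x2 \<in> F"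
proof (cases "w1 + w2 = 0")
  case True
  then have "w1 = 0" "w2 = 0" using w by auto
  then show ?thesis using that[of x1] x by simp
next
  case False
  define c d where "c = w1 / (w1 + w2)" and "d = w2 / (w1 + w2)"
  define x where "x = c *\<^sub>R x1 + d *\<^sub>R x2"
  have cd: "0 \<le> c" "0 \<le> d" "c + d = 1" "0 < w1 \<longleftrightarrow> 0 < c" "0 < w2 \<longleftrightarrow> 0 < d"
    using False w by (auto simp: c_def d_def zero_less_divide_iff simp flip: add_divide_distrib)
  have F': "convex F" using F by (simp add: face_of_def)
  show ?thesis
  proof (rule that)
    show "x \<in> S" unfolding x_def by (rule convexD[OF S x cd(1-3)])
    show "(w1 + w2) *\<^sub>R x = w1 *\<^sub>R x1 + w2 *\<^sub>R x2"
      using False by (simp add: x_def c_def d_def scaleR_add_right)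
    show "x \<in> F \<longrightarrow> 0 < w1 \<longrightarrow> x1 \<in> F"
      using face_of_convex_comb[OF F x(1,2), of c d] cd x_def by auto
    show "x \<in> F \<longrightarrow> 0 < w2 \<longrightarrow> x2 \<in> F"
      using face_of_convex_comb[OF F x(2,1), of d c] cd x_def by (auto simp: add.commute)
    show "0 < w1 + w2 \<longrightarrow> (0 < w1 \<longrightarrow> x1 \<in> F) \<longrightarrow> (0 < w2 \<longrightarrow> x2 \<in> F) \<longrightarrow> x \<in> F"
    proof (intro impI)
      assume *: "0 < w1 \<longrightarrow> x1 \<in> F" "0 < w2 \<longrightarrow> x2 \<in> F"
      consider "c = 0" "d = 1" | "c = 1" "d = 0" | "0 < c" "0 < d" using cd by fastforce
      then show "x \<in> F"
        using * cd convexD[OF F' _ _ cd(1-3)] unfolding x_def by cases auto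
    qed
  qed
qed

section \<open>Products and free sums\<close>

text \<open>The common setting of both constructions: two symmetric bodies in independent subspaces.
  The product is then the Minkowski sum \<open>P + Q\<close>, and the free sum is
  \<open>convex hull (P \<union> Q)\<close>. The finite set \<open>E\<close> provides finite
  dimension.\<close>

locale symmetric_pair =
  fixes U W P Q E :: "'a::real_vector set"
  assumes subspaces: "subspace U" "subspace W" and direct: "U \<inter> W \<subseteq> {0}"
    and subset: "P \<subseteq> U" "Q \<subseteq> W"
    and convex_PQ: "convex P" "convex Q"
    and zero: "0 \<in> P" "0 \<in> Q"
    and sym: "\<And>x. x \<in> P \<Longrightarrow> - x \<in> P" "\<And>y. y \<in> Q \<Longrightarrow> - y \<in> Q"
    and finite_dim: "finite E" "U \<subseteq> span E" "W \<subseteq> span E"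
begin

lemma direct_unique:
  assumes "x + y = x' + y'" "x \<in> U" "x' \<in> U" "y \<in> W" "y' \<in> W"
  shows "x = x'" "y = y'"
proof -
  have "x - x' = y' - y" using assms(1) by (simp add: algebra_simps)
  moreover have "x - x' \<in> U" "y' - y \<in> W" using assms subspaces by (simp_all add: subspace_diff)
  ultimately have "x - x' = 0" using direct by auto
  then show "x = x'" "y = y'" using assms(1) by auto
qed

lemma span_inter: "F1 \<subseteq> U \<Longrightarrow> F2 \<subseteq> W \<Longrightarrow> span F1 \<inter> span F2 \<subseteq> {0}"
  using span_minimal[OF _ subspaces(1)] span_minimal[OF _ subspaces(2)] direct by blast

lemma face_subset: "F1 face_of P \<Longrightarrow> F1 \<subseteq> U" "F2 face_of Q \<Longrightarrow> F2 \<subseteq> W"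
  using face_of_imp_subset subset by blast+

text \<open>Components in \<open>U\<close> and \<open>W\<close> are unique, so a convex combination
  lies in \<open>F1 + F2\<close> only if its components lie in \<open>F1\<close> and
  \<open>F2\<close>; the face condition then applies in each factor.\<close>

lemma face_of_plus:
  assumes F1: "F1 face_of P" and F2: "F2 face_of Q"
  shows "F1 + F2 face_of P + Q"
proof (rule face_ofI_convex_comb)
  show "F1 + F2 \<subseteq> P + Q" using F1 F2 face_of_imp_subset by (intro set_plus_mono2) blast+
  show "convex (F1 + F2)" using F1 F2 by (simp add: convex_set_plus face_of_def)
  fix a b u assume ab: "a \<in> P + Q" "b \<in> P + Q" and u: "0 < u" "u < 1"
    and m: "(1 - u) *\<^sub>R a + u *\<^sub>R b \<in> F1 + F2"
  obtain a1 a2 where a: "a = a1 + a2" "a1 \<in> P" "a2 \<in> Q" using ab(1) by (rule set_plus_elim)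
  obtain b1 b2 where b: "b = b1 + b2" "b1 \<in> P" "b2 \<in> Q" using ab(2) by (rule set_plus_elim)
  obtain x y where xy: "(1 - u) *\<^sub>R a + u *\<^sub>R b = x + y" "x \<in> F1" "y \<in> F2"
    using m by (rule set_plus_elim)
  have eq: "((1 - u) *\<^sub>R a1 + u *\<^sub>R b1) + ((1 - u) *\<^sub>R a2 + u *\<^sub>R b2) = x + y"
    using xy(1) a(1) b(1) by (simp add: algebra_simps)
  have mem: "(1 - u) *\<^sub>R a1 + u *\<^sub>R b1 \<in> U" "(1 - u) *\<^sub>R a2 + u *\<^sub>R b2 \<in> W"
    using a b subset subspaces by (auto intro!: subspace_add subspace_scale)
  have "x \<in> U" "y \<in> W" using xy face_subset F1 F2 by blast+
  then have m1: "(1 - u) *\<^sub>R a1 + u *\<^sub>R b1 \<in> F1" and m2: "(1 - u) *\<^sub>R a2 + u *\<^sub>R b2 \<in> F2"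
    using direct_unique[OF eq mem(1) _ mem(2)] xy by auto
  have m1': "u *\<^sub>R b1 + (1 - u) *\<^sub>R a1 \<in> F1" and m2': "u *\<^sub>R b2 + (1 - u) *\<^sub>R a2 \<in> F2"
    using m1 m2 by (simp_all add: add.commute)
  have "a1 \<in> F1" "a2 \<in> F2" "b1 \<in> F1" "b2 \<in> F2"
    using face_of_convex_comb[OF F1 a(2) b(2) _ _ _ m1] face_of_convex_comb[OF F2 a(3) b(3) _ _ _ m2]
      face_of_convex_comb[OF F1 b(2) a(2) _ _ _ m1'] face_of_convex_comb[OF F2 b(3) a(3) _ _ _ m2'] u
    by auto
  then show "a \<in> F1 + F2 \<and> b \<in> F1 + F2" using a(1) b(1) by (simp add: set_plus_intro)
qed

text \<open>The factors are the projections of \<open>F\<close>. Each is a face because a segment in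
  one factor can be translated by a fixed point of the other.\<close>

lemma face_of_plus_decomp:
  assumes F: "F face_of P + Q" and ne: "F \<noteq> {}"
  obtains F1 F2 where "F1 face_of P" "F2 face_of Q" "F = F1 + F2" "F1 \<noteq> {}" "F2 \<noteq> {}"
proof -
  have cF: "convex F" and FS: "F \<subseteq> P + Q" using F by (auto simp: face_of_def)
  define F1 where "F1 = {x \<in> P. \<exists>y\<in>Q. x + y \<in> F}"
  define F2 where "F2 = {y \<in> Q. \<exists>x\<in>P. x + y \<in> F}"
  have "F1 face_of P"
  proof (rule face_ofI_convex_comb)
    show "convex F1"
    proof (rule convexI)
      fix x x' u v assume *: "x \<in> F1" "x' \<in> F1" "0 \<le> u" "0 \<le> v" "u + v = (1::real)"
      then obtain y y' where y: "y \<in> Q" "y' \<in> Q" "x + y \<in> F" "x' + y' \<in> F" "x \<in> P" "x' \<in> P"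
        by (auto simp: F1_def)
      have "u *\<^sub>R (x + y) + v *\<^sub>R (x' + y') \<in> F" using y * by (intro convexD[OF cF])
      then have "(u *\<^sub>R x + v *\<^sub>R x') + (u *\<^sub>R y + v *\<^sub>R y') \<in> F" by (simp add: algebra_simps)
      then show "u *\<^sub>R x + v *\<^sub>R x' \<in> F1"
        unfolding F1_def using * y convexD[OF convex_PQ(1)] convexD[OF convex_PQ(2)] by blast
    qed
    fix a b u assume *: "a \<in> P" "b \<in> P" "0 < u" "u < 1" "(1 - u) *\<^sub>R a + u *\<^sub>R b \<in> F1"
    then obtain y where y: "y \<in> Q" "((1 - u) *\<^sub>R a + u *\<^sub>R b) + y \<in> F" by (auto simp: F1_def)
    have "(1 - u) *\<^sub>R (a + y) + u *\<^sub>R (b + y) \<in> F" using y(2) by (simp add: algebra_simps)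
    moreover from this have "u *\<^sub>R (b + y) + (1 - u) *\<^sub>R (a + y) \<in> F" by (simp add: add.commute)
    ultimately have "a + y \<in> F" "b + y \<in> F"
      using face_of_convex_comb[OF F, of "a + y" "b + y" "1 - u" u]
        face_of_convex_comb[OF F, of "b + y" "a + y" u "1 - u"] * y(1) set_plus_intro by auto
    then show "a \<in> F1 \<and> b \<in> F1" using * y(1) by (auto simp: F1_def)
  qed (auto simp: F1_def)
  moreover have "F2 face_of Q"
  proof (rule face_ofI_convex_comb)
    show "convex F2"
    proof (rule convexI)
      fix y y' u v assume *: "y \<in> F2" "y' \<in> F2" "0 \<le> u" "0 \<le> v" "u + v = (1::real)"
      then obtain x x' where y: "y \<in> Q" "y' \<in> Q" "x + y \<in> F" "x' + y' \<in> F" "x \<in> P" "x' \<in> P"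
        by (auto simp: F2_def)
      have "u *\<^sub>R (x + y) + v *\<^sub>R (x' + y') \<in> F" using y * by (intro convexD[OF cF])
      then have "(u *\<^sub>R x + v *\<^sub>R x') + (u *\<^sub>R y + v *\<^sub>R y') \<in> F" by (simp add: algebra_simps)
      then show "u *\<^sub>R y + v *\<^sub>R y' \<in> F2"
        unfolding F2_def using * y convexD[OF convex_PQ(1)] convexD[OF convex_PQ(2)] by blast
    qed
    fix a b u assume *: "a \<in> Q" "b \<in> Q" "0 < u" "u < 1" "(1 - u) *\<^sub>R a + u *\<^sub>R b \<in> F2"
    then obtain x where x: "x \<in> P" "x + ((1 - u) *\<^sub>R a + u *\<^sub>R b) \<in> F" by (auto simp: F2_def)
    have "(1 - u) *\<^sub>R (x + a) + u *\<^sub>R (x + b) \<in> F" using x(2) by (simp add: algebra_simps)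
    moreover from this have "u *\<^sub>R (x + b) + (1 - u) *\<^sub>R (x + a) \<in> F" by (simp add: add.commute)
    ultimately have "x + a \<in> F" "x + b \<in> F"
      using face_of_convex_comb[OF F, of "x + a" "x + b" "1 - u" u]
        face_of_convex_comb[OF F, of "x + b" "x + a" u "1 - u"] * x(1) set_plus_intro by auto
    then show "a \<in> F2 \<and> b \<in> F2" using * x(1) by (auto simp: F2_def)
  qed (auto simp: F2_def)
  moreover have "F = F1 + F2"
  proof
    show "F \<subseteq> F1 + F2"
    proof
      fix z assume z: "z \<in> F"
      obtain x y where "z = x + y" "x \<in> P" "y \<in> Q" using FS z by (blast elim: set_plus_elim)
      then show "z \<in> F1 + F2" using z by (auto simp: F1_def F2_def intro!: set_plus_intro)
    qed
    show "F1 + F2 \<subseteq> F"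
    proof
      fix z assume "z \<in> F1 + F2"
      then obtain x y where z: "z = x + y" "x \<in> F1" "y \<in> F2" by (rule set_plus_elim)
      then obtain x' y' where xy: "x \<in> P" "y \<in> Q" "x' \<in> P" "y' \<in> Q" "x + y' \<in> F" "x' + y \<in> F"
        by (auto simp: F1_def F2_def)
      \<comment> \<open>Exchange argument: the midpoint of \<open>x + y'\<close> and
        \<open>x' + y\<close> is also the midpoint of \<open>x + y\<close> and
        \<open>x' + y'\<close>, so the face contains \<open>x + y\<close> as well.\<close>
      have "(1/2) *\<^sub>R (x + y') + (1/2) *\<^sub>R (x' + y) \<in> F"
        using xy by (intro convexD[OF cF]) auto
      then have m: "(1/2) *\<^sub>R (x + y) + (1/2) *\<^sub>R (x' + y') \<in> F"
        by (simp add: algebra_simps)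
      show "z \<in> F"
        unfolding z(1) by (rule face_of_convex_comb[OF F _ _ _ _ _ m]) (use xy set_plus_intro in auto)
    qed
  qed
  moreover have "F1 \<noteq> {}" "F2 \<noteq> {}" using ne \<open>F = F1 + F2\<close> by (auto simp: set_plus_def)
  ultimately show ?thesis using that by blast
qed

lemma plus_subset_imp_subset:
  assumes "F1 + F2 \<subseteq> G1 + G2" "F1 \<subseteq> U" "G1 \<subseteq> U" "F2 \<subseteq> W" "G2 \<subseteq> W" "F1 \<noteq> {}" "F2 \<noteq> {}"
  shows "F1 \<subseteq> G1 \<and> F2 \<subseteq> G2"
proof -
  have "x \<in> G1 \<and> y \<in> G2" if "x \<in> F1" "y \<in> F2" for x y
  proof -
    have "x + y \<in> G1 + G2" using that assms(1) set_plus_intro by blast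
    then obtain x' y' where x': "x + y = x' + y'" "x' \<in> G1" "y' \<in> G2" by (rule set_plus_elim)
    moreover have "x = x'" "y = y'" using direct_unique[OF x'(1)] x' that assms(2-5) by blast+
    ultimately show ?thesis by blast
  qed
  then show ?thesis using assms(6,7) by blast
qed

text \<open>The empty set is removed because it absorbs every other summand.\<close>

lemma inj_on_plus: "inj_on (\<lambda>(F1, F2). F1 + F2) ((Pow U - {{}}) \<times> (Pow W - {{}}))"
proof (rule inj_onI)
  fix X Y assume X: "X \<in> (Pow U - {{}}) \<times> (Pow W - {{}})" and Y: "Y \<in> (Pow U - {{}}) \<times> (Pow W - {{}})"
    and eq: "(case X of (F1, F2) \<Rightarrow> F1 + F2) = (case Y of (F1, F2) \<Rightarrow> F1 + F2)"
  obtain F1 F2 G1 G2 where XY: "X = (F1, F2)" "Y = (G1, G2)" by fastforce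
  have *: "F1 \<subseteq> U" "F2 \<subseteq> W" "F1 \<noteq> {}" "F2 \<noteq> {}" "G1 \<subseteq> U" "G2 \<subseteq> W" "G1 \<noteq> {}" "G2 \<noteq> {}"
    using X Y unfolding XY by simp_all
  have "F1 + F2 = G1 + G2" using eq unfolding XY by simp
  then have "F1 \<subseteq> G1 \<and> F2 \<subseteq> G2" "G1 \<subseteq> F1 \<and> G2 \<subseteq> F2"
    using * by (intro plus_subset_imp_subset; simp)+
  then show "X = Y" unfolding XY by auto
qed

lemma subset_span: "F1 \<subseteq> U \<Longrightarrow> F1 \<subseteq> span E" "F2 \<subseteq> W \<Longrightarrow> F2 \<subseteq> span E"
  using finite_dim by blast+

lemma dim_exists:
  assumes "F \<subseteq> span E" "F \<noteq> {}"
  obtains k where "has_aff_dim F k"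
  using has_aff_dim_iff_dim[OF finite_dim(1) assms(1)] assms(2) by blast

lemma plus_subset_span: "F1 \<subseteq> U \<Longrightarrow> F2 \<subseteq> W \<Longrightarrow> F1 + F2 \<subseteq> span E"
  using subset_span[of F1] subset_span(2)[of F2] by (auto simp: set_plus_def intro: span_add)

text \<open>The direction space of the sum is the direct sum of the two direction spaces.\<close>

lemma has_aff_dim_plus:
  assumes F: "F1 \<subseteq> U" "F2 \<subseteq> W" and d: "has_aff_dim F1 i" "has_aff_dim F2 j"
  shows "has_aff_dim (F1 + F2) k \<longleftrightarrow> k = i + j"
proof -
  obtain a b where ab: "a \<in> F1" "b \<in> F2" using d has_aff_dim_imp_nonempty by blast
  let ?V = "(\<lambda>x. - a + x) ` F1" and ?V' = "(\<lambda>x. - b + x) ` F2"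
  have V: "?V \<subseteq> U" "?V' \<subseteq> W"
    using F ab subspaces by (auto intro!: subspace_diff)
  have i: "dim ?V = i" using has_aff_dim_iff_dim[OF finite_dim(1) subset_span(1)[OF F(1)] ab(1)] d by simp
  have j: "dim ?V' = j" using has_aff_dim_iff_dim[OF finite_dim(1) subset_span(2)[OF F(2)] ab(2)] d by simp
  let ?S = "(\<lambda>x. - (a + b) + x) ` (F1 + F2)"
  have "span ?S = span (?V \<union> ?V')"
  proof (rule antisym; rule span_minimal)
    show "?S \<subseteq> span (?V \<union> ?V')"
    proof safe
      fix z assume "z \<in> F1 + F2"
      then obtain x y where z: "z = x + y" "x \<in> F1" "y \<in> F2" by (rule set_plus_elim)
      have "(- a + x) + (- b + y) \<in> span (?V \<union> ?V')"
        using z by (intro span_add span_base) auto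
      then show "- (a + b) + z \<in> span (?V \<union> ?V')" using z(1) by (simp add: algebra_simps)
    qed
    show "?V \<union> ?V' \<subseteq> span ?S"
    proof safe
      fix x assume "x \<in> F1"
      then have "- (a + b) + (x + b) \<in> span ?S" using ab by (intro span_base imageI set_plus_intro)
      then show "- a + x \<in> span ?S" by (simp add: algebra_simps)
    next
      fix x assume "x \<in> F2"
      then have "- (a + b) + (a + x) \<in> span ?S" using ab by (intro span_base imageI set_plus_intro)
      then show "- b + x \<in> span ?S" by (simp add: algebra_simps)
    qed
  qed simp_all
  then have "dim ?S = dim (?V \<union> ?V')" by (rule span_eq_dim)
  also have "\<dots> = i + j"
    using dim_Un_direct[OF finite_dim(1) _ _ span_inter[OF V]] subset_span V i j by auto
  finally have "dim ?S = i + j" .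
  then show ?thesis
    using has_aff_dim_iff_dim[OF finite_dim(1) plus_subset_span[OF F], of "a + b"] set_plus_intro[OF ab] \<open>dim ?S = i + j\<close> by auto
qed

text \<open>Membership in \<open>F1\<close> or \<open>F2\<close> is demanded only under a positive
  weight; a zero weight goes with an arbitrary point of \<open>P\<close> or \<open>Q\<close>. Empty
  faces are thereby covered. The set on the right is convex by \<open>face_weighted_mean\<close>,
  applied in each factor to the merged weights.\<close>

lemma mem_hull_union:
  assumes F1: "F1 face_of P" and F2: "F2 face_of Q"
  shows "z \<in> convex hull (F1 \<union> F2) \<longleftrightarrow>
    (\<exists>s t x y. 0 \<le> s \<and> 0 \<le> t \<and> s + t = 1 \<and> x \<in> P \<and> y \<in> Q \<and> (0 < s \<longrightarrow> x \<in> F1) \<and> (0 < t \<longrightarrow> y \<in> F2) \<and>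
      z = s *\<^sub>R x + t *\<^sub>R y)" (is "_ \<longleftrightarrow> ?R z")
proof
  have "convex {z. ?R z}"
  proof (rule convexI; unfold mem_Collect_eq)
    fix z1 z2 u v assume z: "?R z1" "?R z2" and uv: "0 \<le> u" "0 \<le> v" "u + v = (1::real)"
    from z(1) obtain s1 t1 x1 y1 where 1: "0 \<le> s1" "0 \<le> t1" "s1 + t1 = 1" "x1 \<in> P" "y1 \<in> Q"
      "0 < s1 \<longrightarrow> x1 \<in> F1" "0 < t1 \<longrightarrow> y1 \<in> F2" "z1 = s1 *\<^sub>R x1 + t1 *\<^sub>R y1" by blast
    from z(2) obtain s2 t2 x2 y2 where 2: "0 \<le> s2" "0 \<le> t2" "s2 + t2 = 1" "x2 \<in> P" "y2 \<in> Q"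
      "0 < s2 \<longrightarrow> x2 \<in> F1" "0 < t2 \<longrightarrow> y2 \<in> F2" "z2 = s2 *\<^sub>R x2 + t2 *\<^sub>R y2" by blast
    have pos: "0 \<le> u * s1" "0 \<le> v * s2" "0 \<le> u * t1" "0 \<le> v * t2"
      using 1 2 uv by simp_all
    obtain x where x: "x \<in> P" "(u * s1 + v * s2) *\<^sub>R x = (u * s1) *\<^sub>R x1 + (v * s2) *\<^sub>R x2"
      "0 < u * s1 + v * s2 \<longrightarrow> (0 < u * s1 \<longrightarrow> x1 \<in> F1) \<longrightarrow> (0 < v * s2 \<longrightarrow> x2 \<in> F1) \<longrightarrow> x \<in> F1"
      "x \<in> F1 \<longrightarrow> 0 < u * s1 \<longrightarrow> x1 \<in> F1" "x \<in> F1 \<longrightarrow> 0 < v * s2 \<longrightarrow> x2 \<in> F1"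
      by (rule face_weighted_mean[OF F1 convex_PQ(1) 1(4) 2(4) pos(1,2)])
    obtain y where y: "y \<in> Q" "(u * t1 + v * t2) *\<^sub>R y = (u * t1) *\<^sub>R y1 + (v * t2) *\<^sub>R y2"
      "0 < u * t1 + v * t2 \<longrightarrow> (0 < u * t1 \<longrightarrow> y1 \<in> F2) \<longrightarrow> (0 < v * t2 \<longrightarrow> y2 \<in> F2) \<longrightarrow> y \<in> F2"
      "y \<in> F2 \<longrightarrow> 0 < u * t1 \<longrightarrow> y1 \<in> F2" "y \<in> F2 \<longrightarrow> 0 < v * t2 \<longrightarrow> y2 \<in> F2"
      by (rule face_weighted_mean[OF F2 convex_PQ(2) 1(5) 2(5) pos(3,4)])
    have "u *\<^sub>R z1 + v *\<^sub>R z2 = (u * s1 + v * s2) *\<^sub>R x + (u * t1 + v * t2) *\<^sub>R y"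
      unfolding x(2) y(2) 1(8) 2(8) by (simp add: algebra_simps)
    moreover have "(u * s1 + v * s2) + (u * t1 + v * t2) = 1"
    proof -
      have "(u * s1 + v * s2) + (u * t1 + v * t2) = u * (s1 + t1) + v * (s2 + t2)"
        by (simp add: algebra_simps)
      then show ?thesis using 1(3) 2(3) uv(3) by simp
    qed
    moreover have "0 < u * s1 + v * s2 \<longrightarrow> x \<in> F1" "0 < u * t1 + v * t2 \<longrightarrow> y \<in> F2"
      using x(3) y(3) 1 2 uv by (auto simp: zero_less_mult_iff)
    moreover have "0 \<le> u * s1 + v * s2" "0 \<le> u * t1 + v * t2" using pos by auto
    ultimately show "?R (u *\<^sub>R z1 + v *\<^sub>R z2)" using x(1) y(1) by blast
  qed
  moreover have "F1 \<union> F2 \<subseteq> {z. ?R z}"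
  proof safe
    fix z assume "z \<in> F1"
    then show "?R z" using face_of_imp_subset[OF F1] zero
      by (intro exI[of _ 1] exI[of _ 0] exI[of _ z]) auto
  next
    fix z assume z: "z \<in> F2"
    have "(0::real) \<le> 0 \<and> (0::real) \<le> 1 \<and> 0 + 1 = (1::real) \<and> 0 \<in> P \<and> z \<in> Q \<and>
      (0 < (0::real) \<longrightarrow> 0 \<in> F1) \<and> (0 < (1::real) \<longrightarrow> z \<in> F2) \<and> z = 0 *\<^sub>R 0 + 1 *\<^sub>R z"
      using z face_of_imp_subset[OF F2] zero by auto
    then show "?R z" by blast
  qed
  ultimately show "?R z" if "z \<in> convex hull (F1 \<union> F2)"
    using that hull_minimal[of "F1 \<union> F2" "{z. ?R z}" convex] by blast
next
  assume "?R z"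
  then obtain s t x y where *: "0 \<le> s" "0 \<le> t" "s + t = 1" "x \<in> P" "y \<in> Q"
      "0 < s \<longrightarrow> x \<in> F1" "0 < t \<longrightarrow> y \<in> F2" "z = s *\<^sub>R x + t *\<^sub>R y" by blast
  consider "s = 0" "t = 1" | "s = 1" "t = 0" | "0 < s" "0 < t" using *(1-3) by fastforce
  then show "z \<in> convex hull (F1 \<union> F2)"
  proof cases
    case 3
    then have "x \<in> convex hull (F1 \<union> F2)" "y \<in> convex hull (F1 \<union> F2)" using * by (auto intro: hull_inc)
    then show ?thesis unfolding *(8) using * by (intro convexD) auto
  qed (use * in \<open>auto intro: hull_inc\<close>)
qed

text \<open>If \<open>s < s'\<close>, then \<open>x'\<close> is a convex combination of
  \<open>0\<close> and \<open>x\<close> with positive weight on \<open>0\<close>, and the face would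
  contain \<open>0\<close>. So a face missing the origin meets a ray only at the last point of
  \<open>S\<close>.\<close>

lemma ray_unique:
  assumes F: "F face_of S" "0 \<in> S" "0 \<notin> F" and "x \<in> S" "0 \<le> s" "s \<le> s'" "0 < s'" "x' \<in> F"
    and eq: "s *\<^sub>R x = s' *\<^sub>R x'"
  shows "s = s'"
proof (rule ccontr)
  assume "s \<noteq> s'"
  then have lt: "s < s'" using assms by simp
  have "(1 / s') *\<^sub>R s *\<^sub>R x = (1 / s') *\<^sub>R s' *\<^sub>R x'" using eq by simp
  then have "x' = (1 - s / s') *\<^sub>R 0 + (s / s') *\<^sub>R x" using assms(7) by simp
  moreover have "0 < 1 - s / s'" using lt assms(7) by simp
  moreover have "0 \<le> s / s'" using assms by simp
  ultimately have "0 \<in> F"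
    using face_of_convex_comb[OF F(1,2) assms(4), of "1 - s / s'" "s / s'"] assms(8) by auto
  then show False using F(3) by simp
qed

text \<open>Compares the given representation with one supplied by \<open>mem_hull_union\<close>.
  The components agree by directness, and \<open>ray_unique\<close> shows that the weights agree
  too, so the points may be compared.\<close>

lemma mem_hull_union_weights:
  assumes F1: "F1 face_of P" "0 \<notin> F1" and F2: "F2 face_of Q" "0 \<notin> F2"
    and st: "0 \<le> s" "0 \<le> t" "s + t = 1" and xy: "x \<in> P" "y \<in> Q"
    and z: "s *\<^sub>R x + t *\<^sub>R y \<in> convex hull (F1 \<union> F2)"
  shows "0 < s \<Longrightarrow> x \<in> F1" "0 < t \<Longrightarrow> y \<in> F2"
proof -
  obtain s' t' x' y' where *: "0 \<le> s'" "0 \<le> t'" "s' + t' = 1" "x' \<in> P" "y' \<in> Q"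
      "0 < s' \<longrightarrow> x' \<in> F1" "0 < t' \<longrightarrow> y' \<in> F2" "s *\<^sub>R x + t *\<^sub>R y = s' *\<^sub>R x' + t' *\<^sub>R y'"
    using z unfolding mem_hull_union[OF F1(1) F2(1)] by blast
  have eq: "s *\<^sub>R x = s' *\<^sub>R x'" "t *\<^sub>R y = t' *\<^sub>R y'"
    using direct_unique[OF *(8)] xy *(4,5) subset subspaces by (meson subsetD subspace_scale)+
  have ss: "s = s'"
  proof -
    \<comment> \<open>\<open>ray_unique\<close> wants the face point to carry the larger weight. As
      both pairs of weights sum to 1, this holds in at least one of the two factors.\<close>
    consider "s \<le> s'" "0 < s'" | "t \<le> t'" "0 < t'" using st *(1-3) by linarith
    then show ?thesis
    proof cases
      case 1
      then show ?thesis using ray_unique[OF F1(1) zero(1) F1(2) xy(1) st(1) 1 _ eq(1)] * by simp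
    next
      case 2
      then have "t = t'" using ray_unique[OF F2(1) zero(2) F2(2) xy(2) st(2) 2 _ eq(2)] * by simp
      then show ?thesis using st *(3) by simp
    qed
  qed
  then have tt: "t = t'" using st *(3) by simp
  show "x \<in> F1" if "0 < s" using that eq(1) ss * by simp
  show "y \<in> F2" if "0 < t" using that eq(2) tt * by simp
qed

text \<open>A point between \<open>a\<close> and \<open>b\<close> is rewritten with one mean
  \<open>x\<close> in \<open>P\<close> and one mean \<open>y\<close> in \<open>Q\<close>.
  \<open>mem_hull_union_weights\<close> puts these means into \<open>F1\<close> and
  \<open>F2\<close>, and the face condition returns to the components of \<open>a\<close> and
  \<open>b\<close>.\<close>

lemma face_of_hull_union:
  assumes F1: "F1 face_of P" "0 \<notin> F1" and F2: "F2 face_of Q" "0 \<notin> F2"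
  shows "convex hull (F1 \<union> F2) face_of convex hull (P \<union> Q)"
proof (rule face_ofI_convex_comb)
  note memR = mem_hull_union[OF face_of_refl[OF convex_PQ(1)] face_of_refl[OF convex_PQ(2)]]
  show "convex hull (F1 \<union> F2) \<subseteq> convex hull (P \<union> Q)"
    using F1(1) F2(1) face_of_imp_subset by (intro hull_mono) blast
  show "convex (convex hull (F1 \<union> F2))" by simp
  fix a b u assume ab: "a \<in> convex hull (P \<union> Q)" "b \<in> convex hull (P \<union> Q)" and u: "0 < u" "u < 1"
    and m: "(1 - u) *\<^sub>R a + u *\<^sub>R b \<in> convex hull (F1 \<union> F2)"
  from ab(1) obtain s1 t1 x1 y1 where 1: "0 \<le> s1" "0 \<le> t1" "s1 + t1 = 1" "x1 \<in> P" "y1 \<in> Q"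
    "a = s1 *\<^sub>R x1 + t1 *\<^sub>R y1" unfolding memR by blast
  from ab(2) obtain s2 t2 x2 y2 where 2: "0 \<le> s2" "0 \<le> t2" "s2 + t2 = 1" "x2 \<in> P" "y2 \<in> Q"
    "b = s2 *\<^sub>R x2 + t2 *\<^sub>R y2" unfolding memR by blast
  let ?v = "1 - u"
  have pos: "0 \<le> ?v * s1" "0 \<le> u * s2" "0 \<le> ?v * t1" "0 \<le> u * t2"
    using 1 2 u by simp_all
  obtain x where x: "x \<in> P" "(?v * s1 + u * s2) *\<^sub>R x = (?v * s1) *\<^sub>R x1 + (u * s2) *\<^sub>R x2"
    "0 < ?v * s1 + u * s2 \<longrightarrow> (0 < ?v * s1 \<longrightarrow> x1 \<in> F1) \<longrightarrow> (0 < u * s2 \<longrightarrow> x2 \<in> F1) \<longrightarrow> x \<in> F1"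
    "x \<in> F1 \<longrightarrow> 0 < ?v * s1 \<longrightarrow> x1 \<in> F1" "x \<in> F1 \<longrightarrow> 0 < u * s2 \<longrightarrow> x2 \<in> F1"
    by (rule face_weighted_mean[OF F1(1) convex_PQ(1) 1(4) 2(4) pos(1,2)])
  obtain y where y: "y \<in> Q" "(?v * t1 + u * t2) *\<^sub>R y = (?v * t1) *\<^sub>R y1 + (u * t2) *\<^sub>R y2"
    "0 < ?v * t1 + u * t2 \<longrightarrow> (0 < ?v * t1 \<longrightarrow> y1 \<in> F2) \<longrightarrow> (0 < u * t2 \<longrightarrow> y2 \<in> F2) \<longrightarrow> y \<in> F2"
    "y \<in> F2 \<longrightarrow> 0 < ?v * t1 \<longrightarrow> y1 \<in> F2" "y \<in> F2 \<longrightarrow> 0 < u * t2 \<longrightarrow> y2 \<in> F2"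
    by (rule face_weighted_mean[OF F2(1) convex_PQ(2) 1(5) 2(5) pos(3,4)])
  have eq: "?v *\<^sub>R a + u *\<^sub>R b = (?v * s1 + u * s2) *\<^sub>R x + (?v * t1 + u * t2) *\<^sub>R y"
    unfolding x(2) y(2) 1(6) 2(6) by (simp add: algebra_simps)
  have sum1: "(?v * s1 + u * s2) + (?v * t1 + u * t2) = 1"
  proof -
    have "(?v * s1 + u * s2) + (?v * t1 + u * t2) = ?v * (s1 + t1) + u * (s2 + t2)"
      by (simp add: algebra_simps)
    then show ?thesis using 1(3) 2(3) by simp
  qed
  have xF: "0 < ?v * s1 + u * s2 \<Longrightarrow> x \<in> F1" and yF: "0 < ?v * t1 + u * t2 \<Longrightarrow> y \<in> F2"
    using mem_hull_union_weights[OF F1 F2 _ _ sum1 x(1) y(1)] m pos unfolding eq by auto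
  have "0 < s1 \<longrightarrow> x1 \<in> F1"
  proof
    assume "0 < s1"
    then have "0 < ?v * s1" using u by simp
    then show "x1 \<in> F1" using x(4) xF pos by auto
  qed
  moreover have "0 < s2 \<longrightarrow> x2 \<in> F1"
  proof
    assume "0 < s2"
    then have "0 < u * s2" using u by simp
    then show "x2 \<in> F1" using x(5) xF pos by auto
  qed
  moreover have "0 < t1 \<longrightarrow> y1 \<in> F2"
  proof
    assume "0 < t1"
    then have "0 < ?v * t1" using u by simp
    then show "y1 \<in> F2" using y(4) yF pos by auto
  qed
  moreover have "0 < t2 \<longrightarrow> y2 \<in> F2"
  proof
    assume "0 < t2"
    then have "0 < u * t2" using u by simp
    then show "y2 \<in> F2" using y(5) yF pos by auto
  qed
  ultimately show "a \<in> convex hull (F1 \<union> F2) \<and> b \<in> convex hull (F1 \<union> F2)"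
    unfolding mem_hull_union[OF F1(1) F2(1)] using 1 2 by blast
qed

lemma symmetric_hull_union:
  assumes "z \<in> convex hull (P \<union> Q)" shows "- z \<in> convex hull (P \<union> Q)"
proof -
  have "uminus ` (convex hull (P \<union> Q)) = convex hull (uminus ` (P \<union> Q))"
    by (rule convex_hull_linear_image) (simp add: linear_uminus)
  also have "\<dots> \<subseteq> convex hull (P \<union> Q)" using sym by (intro hull_mono) auto
  finally show ?thesis using assms by blast
qed

text \<open>By symmetry a proper face misses the origin. Its intersections with \<open>P\<close> and
  \<open>Q\<close> are the two faces, and they recover it since each of its points is a combination
  whose positively weighted parts lie in the face.\<close>

lemma face_of_hull_union_decomp:
  assumes F: "F face_of convex hull (P \<union> Q)" and ne: "F \<noteq> convex hull (P \<union> Q)"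
  obtains F1 F2 where "F1 face_of P" "F2 face_of Q" "0 \<notin> F1" "0 \<notin> F2" "F = convex hull (F1 \<union> F2)"
proof -
  let ?R = "convex hull (P \<union> Q)"
  have n0: "0 \<notin> F"
    using face_of_symmetric_eq[OF F _ symmetric_hull_union] ne by (rule contrapos_nn[rotated])
  have sub: "P \<subseteq> ?R" "Q \<subseteq> ?R" using hull_subset[of "P \<union> Q" convex] by simp_all
  have F1: "F \<inter> P face_of P" and F2: "F \<inter> Q face_of Q"
    using face_of_slice[OF F convex_PQ(1)] face_of_slice[OF F convex_PQ(2)] sub
    by (simp_all add: Int_absorb1)
  have "F = convex hull (F \<inter> P \<union> F \<inter> Q)"
  proof
    show "convex hull (F \<inter> P \<union> F \<inter> Q) \<subseteq> F"
      using F by (intro hull_minimal) (auto simp: face_of_def)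
    show "F \<subseteq> convex hull (F \<inter> P \<union> F \<inter> Q)"
    proof
      fix z assume z: "z \<in> F"
      then have "z \<in> ?R" using F face_of_imp_subset by blast
      then obtain s t x y where *: "0 \<le> s" "0 \<le> t" "s + t = 1" "x \<in> P" "y \<in> Q" "z = s *\<^sub>R x + t *\<^sub>R y"
        unfolding mem_hull_union[OF face_of_refl[OF convex_PQ(1)] face_of_refl[OF convex_PQ(2)]] by blast
      have xR: "x \<in> ?R" "y \<in> ?R" using * sub by auto
      have zF: "s *\<^sub>R x + t *\<^sub>R y \<in> F" "t *\<^sub>R y + s *\<^sub>R x \<in> F" "t + s = 1"
        using z *(3,6) by (simp_all add: add.commute)
      have "x \<in> F" if "0 < s" by (rule face_of_convex_comb[OF F xR that *(2,3) zF(1)])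
      moreover have "y \<in> F" if "0 < t" by (rule face_of_convex_comb[OF F xR(2,1) that *(1) zF(3,2)])
      ultimately have "0 < s \<longrightarrow> x \<in> F \<inter> P" "0 < t \<longrightarrow> y \<in> F \<inter> Q" using * by auto
      with * show "z \<in> convex hull (F \<inter> P \<union> F \<inter> Q)"
        by (intro mem_hull_union[OF F1 F2, THEN iffD2] exI[of _ s] exI[of _ t] exI[of _ x] exI[of _ y] conjI)
    qed
  qed
  then show ?thesis using that[OF F1 F2] n0 by blast
qed

text \<open>A point of \<open>P\<close> has weights 1 and 0, so
  \<open>mem_hull_union_weights\<close> decides its membership. Both faces can thus be read off from
  their join.\<close>

lemma hull_union_Int:
  assumes F1: "F1 face_of P" "0 \<notin> F1" and F2: "F2 face_of Q" "0 \<notin> F2"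
  shows "convex hull (F1 \<union> F2) \<inter> P = F1" "convex hull (F1 \<union> F2) \<inter> Q = F2"
proof -
  have "x \<in> F1" if "x \<in> convex hull (F1 \<union> F2)" "x \<in> P" for x
    using mem_hull_union_weights(1)[OF F1 F2, of 1 0 x 0] that zero by simp
  moreover have "y \<in> F2" if "y \<in> convex hull (F1 \<union> F2)" "y \<in> Q" for y
    using mem_hull_union_weights(2)[OF F1 F2, of 0 1 0 y] that zero by simp
  ultimately show "convex hull (F1 \<union> F2) \<inter> P = F1" "convex hull (F1 \<union> F2) \<inter> Q = F2"
    using face_of_imp_subset[OF F1(1)] face_of_imp_subset[OF F2(1)] hull_subset[of "F1 \<union> F2" convex]
    by auto
qed

lemma inj_on_hull_union:
  "inj_on (\<lambda>(F1, F2). convex hull (F1 \<union> F2))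
    ({F. F face_of P \<and> 0 \<notin> F} \<times> {F. F face_of Q \<and> 0 \<notin> F})"
proof (rule inj_onI, clarify)
  fix F1 F2 G1 G2
  assume *: "F1 face_of P" "0 \<notin> F1" "F2 face_of Q" "0 \<notin> F2" "G1 face_of P" "0 \<notin> G1" "G2 face_of Q" "0 \<notin> G2"
    and eq: "convex hull (F1 \<union> F2) = convex hull (G1 \<union> G2)"
  show "F1 = G1 \<and> F2 = G2"
    using hull_union_Int[OF *(1-4)] hull_union_Int[OF *(5-8)] eq by simp
qed

lemma zero_notin_hull_union:
  assumes "F1 face_of P" "0 \<notin> F1" "F2 face_of Q" "0 \<notin> F2"
  shows "0 \<notin> convex hull (F1 \<union> F2)"
  using hull_union_Int(1)[OF assms] zero(1) assms(2) by blast

lemma hull_union_subset_span: "F1 \<subseteq> U \<Longrightarrow> F2 \<subseteq> W \<Longrightarrow> convex hull (F1 \<union> F2) \<subseteq> span E"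
  using subset_span by (intro hull_minimal) (auto intro: subspace_imp_convex)

text \<open>The linear dimensions \<open>i + 1\<close> and \<open>j + 1\<close> add up, and the join
  misses the origin, so its affine dimension is one less than the sum.\<close>

lemma has_aff_dim_hull_union:
  assumes F1: "F1 face_of P" "0 \<notin> F1" and F2: "F2 face_of Q" "0 \<notin> F2"
    and d: "has_aff_dim F1 i" "has_aff_dim F2 j"
  shows "has_aff_dim (convex hull (F1 \<union> F2)) k \<longleftrightarrow> k = Suc (i + j)"
proof -
  note sub = face_subset(1)[OF F1(1)] face_subset(2)[OF F2(1)]
  have ne: "F1 \<noteq> {}" "F2 \<noteq> {}" using d has_aff_dim_imp_nonempty by blast+
  have i: "dim F1 = Suc i"
    using has_aff_dim_iff_dim_Suc[OF finite_dim(1) subset_span(1)[OF sub(1)] ne(1)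
        zero_notin_affine_hull_face[OF F1(1) zero(1) F1(2)]] d by simp
  have j: "dim F2 = Suc j"
    using has_aff_dim_iff_dim_Suc[OF finite_dim(1) subset_span(2)[OF sub(2)] ne(2)
        zero_notin_affine_hull_face[OF F2(1) zero(2) F2(2)]] d by simp
  have "span (convex hull (F1 \<union> F2)) = span (F1 \<union> F2)"
    by (intro antisym span_mono hull_subset span_minimal convex_hull_subset_span subspace_span)
  then have "dim (convex hull (F1 \<union> F2)) = dim (F1 \<union> F2)" by (rule span_eq_dim)
  also have "\<dots> = Suc i + Suc j"
    using dim_Un_direct[OF finite_dim(1) _ _ span_inter[OF sub]] subset_span sub i j by auto
  finally have dim: "dim (convex hull (F1 \<union> F2)) = Suc (Suc (i + j))" by simp
  have "0 \<in> convex hull (P \<union> Q)" using zero by (simp add: hull_inc)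
  then have "0 \<notin> affine hull (convex hull (F1 \<union> F2))"
    by (rule zero_notin_affine_hull_face[OF face_of_hull_union[OF F1 F2] _ zero_notin_hull_union[OF F1 F2]])
  then show ?thesis
    using has_aff_dim_iff_dim_Suc[OF finite_dim(1) hull_union_subset_span[OF sub]] dim ne by auto
qed

text \<open>Here both bodies contain the origin, so affine and linear dimensions coincide and no
  extra dimension appears.\<close>

lemma has_aff_dim_hull_union_whole:
  assumes d: "has_aff_dim P i" "has_aff_dim Q j"
  shows "has_aff_dim (convex hull (P \<union> Q)) k \<longleftrightarrow> k = i + j"
proof -
  have "span (convex hull (P \<union> Q)) = span (P \<union> Q)"
    by (intro antisym span_mono hull_subset span_minimal convex_hull_subset_span subspace_span)
  then have "dim (convex hull (P \<union> Q)) = dim (P \<union> Q)" by (rule span_eq_dim)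
  also have "\<dots> = dim P + dim Q"
    using dim_Un_direct[OF finite_dim(1) _ _ span_inter[OF subset]] subset_span subset by auto
  also have "\<dots> = i + j"
    using has_aff_dim_iff_dim[OF finite_dim(1) subset_span(1)[OF subset(1)] zero(1)]
      has_aff_dim_iff_dim[OF finite_dim(1) subset_span(2)[OF subset(2)] zero(2)] d by simp
  finally show ?thesis
    using has_aff_dim_iff_dim[OF finite_dim(1) hull_union_subset_span[OF subset], of 0] zero
    by (auto simp: hull_inc)
qed

end

section \<open>Face numbers of products and free sums\<close>

context symmetric_pair
begin

text \<open>Finiteness has to be carried along, since \<open>num_faces\<close> is a cardinality and
  \<open>card\<close> is monotone only below a finite set. The empty face is inserted
  separately.\<close>

lemma finite_faces_plus:
  assumes "finite {F. F face_of P}" "finite {F. F face_of Q}"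
  shows "finite {F. F face_of P + Q}"
proof (rule finite_subset)
  show "{F. F face_of P + Q} \<subseteq> insert {} ((\<lambda>(F1, F2). F1 + F2) ` ({F. F face_of P} \<times> {F. F face_of Q}))"
  proof
    fix F assume "F \<in> {F. F face_of P + Q}"
    then have F: "F face_of P + Q" by simp
    show "F \<in> insert {} ((\<lambda>(F1, F2). F1 + F2) ` ({F. F face_of P} \<times> {F. F face_of Q}))"
    proof (cases "F = {}")
      case False
      obtain F1 F2 where D: "F1 face_of P" "F2 face_of Q" "F = F1 + F2" "F1 \<noteq> {}" "F2 \<noteq> {}"
        by (rule face_of_plus_decomp[OF F False])
      then show ?thesis by (intro insertI2 image_eqI[of _ _ "(F1, F2)"]) simp_all
    qed simp
  qed
qed (use assms in simp)

lemma finite_faces_hull_union: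
  assumes "finite {F. F face_of P}" "finite {F. F face_of Q}"
  shows "finite {F. F face_of convex hull (P \<union> Q)}"
proof (rule finite_subset)
  let ?A = "insert (convex hull (P \<union> Q)) ((\<lambda>(F1, F2). convex hull (F1 \<union> F2)) ` ({F. F face_of P} \<times> {F. F face_of Q}))"
  show "{F. F face_of convex hull (P \<union> Q)} \<subseteq> ?A"
  proof
    fix F assume "F \<in> {F. F face_of convex hull (P \<union> Q)}"
    then have F: "F face_of convex hull (P \<union> Q)" by simp
    show "F \<in> ?A"
    proof (cases "F = convex hull (P \<union> Q)")
      case False
      obtain F1 F2 where D: "F1 face_of P" "F2 face_of Q" "0 \<notin> F1" "0 \<notin> F2" "F = convex hull (F1 \<union> F2)"
        by (rule face_of_hull_union_decomp[OF F False])
      then show ?thesis by (intro insertI2 image_eqI[of _ _ "(F1, F2)"]) simp_all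
    qed simp
  qed
qed (use assms in simp)

lemma num_faces_plus_le:
  assumes fin: "finite {F. F face_of P}" "finite {F. F face_of Q}"
  shows "num_faces k (P + Q) \<le> (\<Sum>i\<le>k. num_faces i P * num_faces (k - i) Q)"
proof -
  let ?A = "\<lambda>i S. {F. F face_of S \<and> has_aff_dim F i}"
  let ?X = "\<lambda>i. (\<lambda>(F1, F2). F1 + F2) ` (?A i P \<times> ?A (k - i) Q)"
  have finX: "finite (?A i P \<times> ?A j Q)" for i j
    using fin by simp
  have "?A k (P + Q) \<subseteq> (\<Union>i\<le>k. ?X i)"
  proof
    fix F assume "F \<in> ?A k (P + Q)"
    then have F: "F face_of P + Q" "has_aff_dim F k" by simp_all
    obtain F1 F2 where D: "F1 face_of P" "F2 face_of Q" "F = F1 + F2" "F1 \<noteq> {}" "F2 \<noteq> {}"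
      by (rule face_of_plus_decomp[OF F(1) has_aff_dim_imp_nonempty[OF F(2)]])
    note sub = face_subset(1)[OF D(1)] face_subset(2)[OF D(2)]
    obtain i where i: "has_aff_dim F1 i" using dim_exists[OF subset_span(1)[OF sub(1)] D(4)] .
    obtain j where j: "has_aff_dim F2 j" using dim_exists[OF subset_span(2)[OF sub(2)] D(5)] .
    have "k = i + j" using has_aff_dim_plus[OF sub i j] F(2) D(3) by simp
    then have "i \<le> k" "(F1, F2) \<in> ?A i P \<times> ?A (k - i) Q" using D i j by auto
    then show "F \<in> (\<Union>i\<le>k. ?X i)" using D(3) by (intro UN_I[of i] image_eqI[of _ _ "(F1, F2)"]) simp_all
  qed
  then have "card (?A k (P + Q)) \<le> card (\<Union>i\<le>k. ?X i)"
    using finX by (intro card_mono finite_UN_I finite_imageI) auto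
  also have "\<dots> \<le> (\<Sum>i\<le>k. card (?X i))" by (rule card_UN_le) simp
  also have "\<dots> \<le> (\<Sum>i\<le>k. card (?A i P \<times> ?A (k - i) Q))"
    using finX by (intro sum_mono card_image_le) auto
  finally show ?thesis by (simp add: num_faces_def card_cartesian_product)
qed

lemma num_faces_plus_ge:
  assumes fin: "finite {F. F face_of P}" "finite {F. F face_of Q}"
  shows "num_faces i P * num_faces j Q \<le> num_faces (i + j) (P + Q)"
proof -
  let ?A = "\<lambda>i S. {F. F face_of S \<and> has_aff_dim F i}"
  have "?A i P \<times> ?A j Q \<subseteq> (Pow U - {{}}) \<times> (Pow W - {{}})"
  proof (intro Sigma_mono subsetI)
    show "F \<in> Pow U - {{}}" if "F \<in> ?A i P" for F
      using that face_subset(1) has_aff_dim_imp_nonempty by blast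
    show "F \<in> Pow W - {{}}" if "F \<in> ?A j Q" for F
      using that face_subset(2) has_aff_dim_imp_nonempty by blast
  qed
  then have inj: "inj_on (\<lambda>(F1, F2). F1 + F2) (?A i P \<times> ?A j Q)"
    by (rule inj_on_subset[OF inj_on_plus])
  have "num_faces i P * num_faces j Q = card ((\<lambda>(F1, F2). F1 + F2) ` (?A i P \<times> ?A j Q))"
    unfolding card_image[OF inj] by (simp add: num_faces_def card_cartesian_product)
  also have "\<dots> \<le> card (?A (i + j) (P + Q))"
  proof (rule card_mono)
    show "finite (?A (i + j) (P + Q))" using finite_faces_plus[OF fin] by simp
    show "(\<lambda>(F1, F2). F1 + F2) ` (?A i P \<times> ?A j Q) \<subseteq> ?A (i + j) (P + Q)"
    proof
      fix F assume "F \<in> (\<lambda>(F1, F2). F1 + F2) ` (?A i P \<times> ?A j Q)"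
      then obtain F1 F2 where *: "F = F1 + F2" "F1 face_of P" "has_aff_dim F1 i" "F2 face_of Q" "has_aff_dim F2 j"
        by auto
      then show "F \<in> ?A (i + j) (P + Q)"
        using has_aff_dim_plus[OF face_subset(1)[OF *(2)] face_subset(2)[OF *(4)] *(3,5)] face_of_plus by simp
    qed
  qed
  finally show ?thesis by (simp add: num_faces_def)
qed

text \<open>The terms account for the whole body, the joins with an empty face on one side, and the
  proper joins; these have total dimension \<open>k - 1\<close> in the factors because joining adds
  one.\<close>

lemma num_faces_hull_union_le:
  assumes fin: "finite {F. F face_of P}" "finite {F. F face_of Q}"
  shows "num_faces k (convex hull (P \<union> Q))
    \<le> 1 + num_faces k P + num_faces k Q + (\<Sum>i<k. num_faces i P * num_faces (k - 1 - i) Q)"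
proof -
  let ?R = "convex hull (P \<union> Q)"
  let ?A = "\<lambda>i S. {F. F face_of S \<and> has_aff_dim F i}"
  let ?X = "\<lambda>i. (\<lambda>(F1, F2). convex hull (F1 \<union> F2)) ` (?A i P \<times> ?A (k - 1 - i) Q)"
  have finX: "finite (?A i P \<times> ?A j Q)" for i j
    using fin by simp
  have finU: "finite (\<Union>i<k. ?X i)" using finX by (intro finite_UN_I finite_imageI) auto
  have "?A k ?R \<subseteq> insert ?R (?A k P \<union> ?A k Q \<union> (\<Union>i<k. ?X i))"
  proof
    fix F assume "F \<in> ?A k ?R"
    then have F: "F face_of ?R" "has_aff_dim F k" by simp_all
    show "F \<in> insert ?R (?A k P \<union> ?A k Q \<union> (\<Union>i<k. ?X i))"
    proof (cases "F = ?R")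
      case False
      obtain F1 F2 where D: "F1 face_of P" "F2 face_of Q" "0 \<notin> F1" "0 \<notin> F2" "F = convex hull (F1 \<union> F2)"
        by (rule face_of_hull_union_decomp[OF F(1) False])
      have cv: "convex hull F1 = F1" "convex hull F2 = F2"
        using D(1,2) by (auto simp: face_of_def convex_hull_eq)
      note sub = face_subset(1)[OF D(1)] face_subset(2)[OF D(2)]
      consider "F1 = {}" | "F2 = {}" | "F1 \<noteq> {}" "F2 \<noteq> {}" by blast
      then show ?thesis
      proof cases
        case 1
        then have "F \<in> ?A k Q" using D F cv by simp
        then show ?thesis by blast
      next
        case 2
        then have "F \<in> ?A k P" using D F cv by simp
        then show ?thesis by blast
      next
        case 3
        obtain i where i: "has_aff_dim F1 i" using dim_exists[OF subset_span(1)[OF sub(1)] 3(1)] .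
        obtain j where j: "has_aff_dim F2 j" using dim_exists[OF subset_span(2)[OF sub(2)] 3(2)] .
        have "k = Suc (i + j)" using has_aff_dim_hull_union[OF D(1,3,2,4) i j] F(2) D(5) by simp
        then have "i < k" "(F1, F2) \<in> ?A i P \<times> ?A (k - 1 - i) Q" using D i j by auto
        then have "F \<in> (\<Union>i<k. ?X i)"
          using D(5) by (intro UN_I[of i] image_eqI[of _ _ "(F1, F2)"]) simp_all
        then show ?thesis by blast
      qed
    qed simp
  qed
  then have "card (?A k ?R) \<le> card (insert ?R (?A k P \<union> ?A k Q \<union> (\<Union>i<k. ?X i)))"
    using fin finU by (intro card_mono) simp_all
  also have "\<dots> \<le> 1 + card (?A k P \<union> ?A k Q \<union> (\<Union>i<k. ?X i))"
    using fin finU by (simp add: card_insert_if)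
  also have "\<dots> \<le> 1 + (card (?A k P) + card (?A k Q) + card (\<Union>i<k. ?X i))"
    using card_Un_le[of "?A k P \<union> ?A k Q" "\<Union>i<k. ?X i"] card_Un_le[of "?A k P" "?A k Q"] by linarith
  also have "card (\<Union>i<k. ?X i) \<le> (\<Sum>i<k. card (?X i))" by (rule card_UN_le) simp
  also have "\<dots> \<le> (\<Sum>i<k. card (?A i P \<times> ?A (k - 1 - i) Q))"
    using finX by (intro sum_mono card_image_le) auto
  finally show ?thesis by (simp add: num_faces_def card_cartesian_product)
qed

lemma has_aff_dim_unique:
  assumes "F \<subseteq> span E" "has_aff_dim F i" "has_aff_dim F j" shows "i = j"
proof -
  obtain a where "a \<in> F" using has_aff_dim_imp_nonempty[OF assms(2)] by blast
  then show ?thesis using has_aff_dim_iff_dim[OF finite_dim(1) assms(1)] assms(2,3) by simp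
qed

lemma zero_notin_proper_face:
  assumes "F face_of P" "has_aff_dim F i" "has_aff_dim P p" "i < p"
  shows "0 \<notin> F"
proof
  assume "0 \<in> F"
  then have "F = P" using face_of_symmetric_eq[OF assms(1) _ sym(1)] by simp
  then show False using has_aff_dim_unique[OF subset_span(1)[OF subset(1)]] assms(2-4) by fastforce
qed

lemma zero_notin_proper_face':
  assumes "F face_of Q" "has_aff_dim F i" "has_aff_dim Q q" "i < q"
  shows "0 \<notin> F"
proof
  assume "0 \<in> F"
  then have "F = Q" using face_of_symmetric_eq[OF assms(1) _ sym(2)] by simp
  then show False using has_aff_dim_unique[OF subset_span(2)[OF subset(2)]] assms(2-4) by fastforce
qed

text \<open>The bounds \<open>i < p\<close> and \<open>j < q\<close> make the faces proper, so by
  symmetry they miss the origin and can be joined injectively.\<close>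

lemma num_faces_hull_union_ge:
  assumes fin: "finite {F. F face_of P}" "finite {F. F face_of Q}"
    and d: "has_aff_dim P p" "has_aff_dim Q q" and ij: "i < p" "j < q"
  shows "num_faces i P * num_faces j Q \<le> num_faces (Suc (i + j)) (convex hull (P \<union> Q))"
proof -
  let ?A = "\<lambda>i S. {F. F face_of S \<and> has_aff_dim F i}"
  let ?f = "\<lambda>(F1, F2). convex hull (F1 \<union> F2)"
  have "?A i P \<times> ?A j Q \<subseteq> {F. F face_of P \<and> 0 \<notin> F} \<times> {F. F face_of Q \<and> 0 \<notin> F}"
    using zero_notin_proper_face[OF _ _ d(1) ij(1)] zero_notin_proper_face'[OF _ _ d(2) ij(2)] by auto
  then have inj: "inj_on ?f (?A i P \<times> ?A j Q)"
    by (rule inj_on_subset[OF inj_on_hull_union])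
  have "num_faces i P * num_faces j Q = card (?f ` (?A i P \<times> ?A j Q))"
    unfolding card_image[OF inj] by (simp add: num_faces_def card_cartesian_product)
  also have "\<dots> \<le> card (?A (Suc (i + j)) (convex hull (P \<union> Q)))"
  proof (rule card_mono)
    show "finite (?A (Suc (i + j)) (convex hull (P \<union> Q)))"
      using finite_faces_hull_union[OF fin] by simp
    show "?f ` (?A i P \<times> ?A j Q) \<subseteq> ?A (Suc (i + j)) (convex hull (P \<union> Q))"
    proof
      fix F assume "F \<in> ?f ` (?A i P \<times> ?A j Q)"
      then obtain F1 F2 where *: "F = convex hull (F1 \<union> F2)" "F1 face_of P" "has_aff_dim F1 i"
        "F2 face_of Q" "has_aff_dim F2 j" by auto
      note 0 = zero_notin_proper_face[OF *(2,3) d(1) ij(1)] zero_notin_proper_face'[OF *(4,5) d(2) ij(2)]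
      show "F \<in> ?A (Suc (i + j)) (convex hull (P \<union> Q))"
        using face_of_hull_union[OF *(2) 0(1) *(4) 0(2)]
          has_aff_dim_hull_union[OF *(2) 0(1) *(4) 0(2) *(3,5)] *(1) by simp
    qed
  qed
  finally show ?thesis by (simp add: num_faces_def)
qed

lemma num_faces_hull_union_ge_left:
  assumes fin: "finite {F. F face_of P}" "finite {F. F face_of Q}"
    and d: "has_aff_dim P p" and i: "i < p"
  shows "num_faces i P \<le> num_faces i (convex hull (P \<union> Q))"
  unfolding num_faces_def
proof (rule card_mono)
  show "finite {F. F face_of convex hull (P \<union> Q) \<and> has_aff_dim F i}"
    using finite_faces_hull_union[OF fin] by simp
  show "{F. F face_of P \<and> has_aff_dim F i} \<subseteq> {F. F face_of convex hull (P \<union> Q) \<and> has_aff_dim F i}"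
  proof
    fix F assume "F \<in> {F. F face_of P \<and> has_aff_dim F i}"
    then have F: "F face_of P" "has_aff_dim F i" by simp_all
    \<comment> \<open>A proper face of \<open>P\<close> is its own join with the empty face of
      \<open>Q\<close>.\<close>
    have "convex hull (F \<union> {}) face_of convex hull (P \<union> Q)"
      using zero_notin_proper_face[OF F d i] by (intro face_of_hull_union F) auto
    moreover have "convex hull F = F" using F(1) by (auto simp: face_of_def convex_hull_eq)
    ultimately show "F \<in> {F. F face_of convex hull (P \<union> Q) \<and> has_aff_dim F i}"
      using F(2) by simp
  qed
qed

end

section \<open>The coordinate representation\<close>

lemma linear_shift_coords: "linear (shift_coords d)"
  by (rule linearI; rule poly_mapping_eqI)
    (simp_all add: lookup_add lookup_scaleR_poly_mapping shift_coords.rep_eq)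

lemma inj_shift_coords: "inj (shift_coords d)"
proof (rule injI)
  fix x y assume eq: "shift_coords d x = shift_coords d y"
  show "x = y"
  proof (rule poly_mapping_eqI)
    fix i
    have "Poly_Mapping.lookup (shift_coords d x) (i + d) = Poly_Mapping.lookup (shift_coords d y) (i + d)"
      using eq by simp
    then show "Poly_Mapping.lookup x i = Poly_Mapping.lookup y i" by (simp add: shift_coords.rep_eq)
  qed
qed

text \<open>Supplies the finite spanning set that the dimension lemmas ask for.\<close>

lemma coord_space_subset_span: "coord_space d \<subseteq> span ((\<lambda>i. Poly_Mapping.single i 1) ` {..<d})"
proof
  fix x :: "nat \<Rightarrow>\<^sub>0 real" assume x: "x \<in> coord_space d"
  have "x = (\<Sum>i<d. Poly_Mapping.lookup x i *\<^sub>R Poly_Mapping.single i 1)"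
  proof (rule poly_mapping_eqI)
    fix j
    have "Poly_Mapping.lookup (\<Sum>i<d. Poly_Mapping.lookup x i *\<^sub>R Poly_Mapping.single i 1) j
      = (\<Sum>i<d. if i = j then Poly_Mapping.lookup x i else 0)"
      by (simp add: lookup_sum lookup_scaleR_poly_mapping lookup_single when_def if_distrib cong: if_cong)
    also have "\<dots> = Poly_Mapping.lookup x j" using x by (auto simp: coord_space_iff)
    finally show "Poly_Mapping.lookup x j
      = Poly_Mapping.lookup (\<Sum>i<d. Poly_Mapping.lookup x i *\<^sub>R Poly_Mapping.single i 1) j" by simp
  qed
  also have "\<dots> \<in> span ((\<lambda>i. Poly_Mapping.single i 1) ` {..<d})"
    by (intro span_sum span_scale span_base) auto
  finally show "x \<in> span ((\<lambda>i. Poly_Mapping.single i 1) ` {..<d})" .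
qed

lemma shift_coords_in_coord_space: "x \<in> coord_space d \<Longrightarrow> shift_coords d x \<in> coord_space (2 * d)"
  by (simp add: coord_space_iff shift_coords.rep_eq)

lemma dim_linear_inj_image:
  fixes f :: "'a::real_vector \<Rightarrow> 'b::real_vector"
  assumes f: "linear f" "inj f"
  shows "dim (f ` V) = dim V"
proof -
  obtain B where B: "B \<subseteq> V" "independent B" "V \<subseteq> span B" "card B = dim V"
    by (rule basis_exists)
  have "span B = span V" using B by (metis span_eq span_superset subset_trans)
  then have "span (f ` B) = span (f ` V)" by (simp add: linear_span_image[OF f(1)])
  moreover have "independent (f ` B)"
    using linear_independent_injective_image[OF f(1) B(2)] f(2) by (simp add: inj_on_subset)
  ultimately have "dim (f ` V) = card (f ` B)" by (rule dim_eq_card)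
  then show ?thesis using B(4) f(2) by (simp add: card_image inj_on_subset)
qed

lemma has_aff_dim_shift_coords:
  assumes F: "F \<subseteq> coord_space d"
  shows "has_aff_dim (shift_coords d ` F) k \<longleftrightarrow> has_aff_dim F k"
proof (cases "F = {}")
  case True
  then show ?thesis using has_aff_dim_imp_nonempty by blast
next
  case False
  then obtain a where a: "a \<in> F" by blast
  let ?E = "\<lambda>d. (\<lambda>i. Poly_Mapping.single i (1::real)) ` {..<d}"
  have "shift_coords d ` F \<subseteq> span (?E (2 * d))"
    using F shift_coords_in_coord_space coord_space_subset_span by blast
  then have "has_aff_dim (shift_coords d ` F) k
      \<longleftrightarrow> dim ((\<lambda>x. - shift_coords d a + x) ` shift_coords d ` F) = k"
    using a by (intro has_aff_dim_iff_dim) auto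
  also have "(\<lambda>x. - shift_coords d a + x) ` shift_coords d ` F = shift_coords d ` (\<lambda>x. - a + x) ` F"
    by (simp add: image_image linear_diff[OF linear_shift_coords])
  also have "dim \<dots> = dim ((\<lambda>x. - a + x) ` F)"
    by (rule dim_linear_inj_image[OF linear_shift_coords inj_shift_coords])
  also have "\<dots> = k \<longleftrightarrow> has_aff_dim F k"
    using F a coord_space_subset_span by (intro has_aff_dim_iff_dim[symmetric, of "?E d"]) auto
  finally show ?thesis .
qed

lemma num_faces_shift_coords:
  assumes P: "P \<subseteq> coord_space d"
  shows "num_faces k (shift_coords d ` P) = num_faces k P"
proof -
  note lin = linear_shift_coords[of d] inj_shift_coords[of d]
  have "{F. F face_of shift_coords d ` P \<and> has_aff_dim F k}
      = (`) (shift_coords d) ` {F. F face_of P \<and> has_aff_dim F k}"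
  proof -
    have "{F. F face_of shift_coords d ` P \<and> has_aff_dim F k}
      = {F \<in> (`) (shift_coords d) ` {F. F face_of P}. has_aff_dim F k}"
      using faces_of_linear_image[OF lin, of P] by auto
    also have "\<dots> = (`) (shift_coords d) ` {F. F face_of P \<and> has_aff_dim F k}"
    proof -
      have "has_aff_dim (shift_coords d ` F) k \<longleftrightarrow> has_aff_dim F k" if "F face_of P" for F
        using that P face_of_imp_subset by (intro has_aff_dim_shift_coords) blast
      then show ?thesis by auto
    qed
    finally show ?thesis .
  qed
  moreover have "inj_on ((`) (shift_coords d)) A" for A
    by (rule inj_onI) (simp add: inj_image_eq_iff[OF lin(2)])
  ultimately show ?thesis by (simp add: num_faces_def card_image)
qed

lemma pair_coords_zero:
  "pair_coords d x 0 = x" "pair_coords d 0 y = shift_coords d y"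
  by (simp_all add: pair_coords_def linear_0[OF linear_shift_coords])

lemma linear_single: "linear (\<lambda>t::real. Poly_Mapping.single i t)"
  by (rule linearI; rule poly_mapping_eqI)
    (simp_all add: lookup_add lookup_scaleR_poly_mapping lookup_single when_def)

lemma inj_single: "inj (\<lambda>t::real. Poly_Mapping.single i t)"
  by (rule injI) (metis lookup_single_eq)

lemma basic_polytope_0: "basic_polytope a 0 = (\<lambda>t. Poly_Mapping.single 0 t) ` {-1..1}"
  by auto

text \<open>Placing the second copy by \<open>shift_coords\<close> turns the Cartesian product into
  a Minkowski sum, the form treated in \<open>symmetric_pair\<close>.\<close>

lemma basic_polytope_product:
  assumes "Suc n \<in> beatty_set a"
  shows "basic_polytope a (Suc n) = basic_polytope a n + shift_coords (2 ^ n) ` basic_polytope a n"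
  using assms by (auto simp: pair_coords_def set_plus_def)

lemma basic_polytope_free_sum:
  assumes "Suc n \<notin> beatty_set a"
  shows "basic_polytope a (Suc n)
    = convex hull (basic_polytope a n \<union> shift_coords (2 ^ n) ` basic_polytope a n)"
  using assms by (simp add: pair_coords_zero setcompr_eq_image)

declare basic_polytope.simps [simp del]

lemma coord_space_Int_shift_coords: "coord_space d \<inter> range (shift_coords d) \<subseteq> {0}"
proof clarsimp
  fix x :: "nat \<Rightarrow>\<^sub>0 real" assume "shift_coords d x \<in> coord_space d"
  then show "shift_coords d x = 0"
    by (intro poly_mapping_eqI) (auto simp: coord_space_iff shift_coords.rep_eq)
qed

section \<open>The basic polytopes as symmetric pairs\<close>

abbreviation "double_pair a n \<equiv>
  symmetric_pair (coord_space (2 ^ n)) (shift_coords (2 ^ n) ` coord_space (2 ^ n))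
    (basic_polytope a n) (shift_coords (2 ^ n) ` basic_polytope a n)
    ((\<lambda>i. Poly_Mapping.single i 1) ` {..<2 ^ Suc n})"

text \<open>The subspaces are the first and the second block of \<open>2 ^ n\<close> coordinates, so
  only convexity, the origin and symmetry of one polytope remain to be checked.\<close>

lemma double_pairI:
  assumes "convex (basic_polytope a n)" "0 \<in> basic_polytope a n"
    and sym: "\<And>x. x \<in> basic_polytope a n \<Longrightarrow> - x \<in> basic_polytope a n"
  shows "double_pair a n"
proof
  note lin = linear_shift_coords[of "2 ^ n"]
  show "subspace (shift_coords (2 ^ n) ` coord_space (2 ^ n))"
    by (rule linear_subspace_image[OF lin subspace_coord_space])
  show "convex (shift_coords (2 ^ n) ` basic_polytope a n)"
    by (rule convex_linear_image[OF lin assms(1)])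
  show "0 \<in> shift_coords (2 ^ n) ` basic_polytope a n"
    using imageI[OF assms(2), of "shift_coords (2 ^ n)"] by (simp add: linear_0[OF lin])
  show "- y \<in> shift_coords (2 ^ n) ` basic_polytope a n"
    if "y \<in> shift_coords (2 ^ n) ` basic_polytope a n" for y
    using that
  proof
    fix x assume "y = shift_coords (2 ^ n) x" "x \<in> basic_polytope a n"
    then show ?thesis using sym by (intro image_eqI[of _ _ "- x"]) (simp_all add: linear_neg[OF lin])
  qed
  have "coord_space (2 ^ n) \<subseteq> coord_space (2 ^ Suc n)" by (auto simp: coord_space_iff)
  then show "coord_space (2 ^ n) \<subseteq> span ((\<lambda>i. Poly_Mapping.single i 1) ` {..<2 ^ Suc n})"
    using coord_space_subset_span by blast
  have "shift_coords (2 ^ n) ` coord_space (2 ^ n) \<subseteq> coord_space (2 ^ Suc n)"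
    using shift_coords_in_coord_space[of _ "2 ^ n"] by auto
  then show "shift_coords (2 ^ n) ` coord_space (2 ^ n) \<subseteq> span ((\<lambda>i. Poly_Mapping.single i 1) ` {..<2 ^ Suc n})"
    using coord_space_subset_span by (rule subset_trans)
  show "coord_space (2 ^ n) \<inter> shift_coords (2 ^ n) ` coord_space (2 ^ n) \<subseteq> {0}"
    using coord_space_Int_shift_coords by blast
  show "shift_coords (2 ^ n) ` basic_polytope a n \<subseteq> shift_coords (2 ^ n) ` coord_space (2 ^ n)"
    by (rule image_mono[OF basic_polytope_subset])
  show "basic_polytope a n \<subseteq> coord_space (2 ^ n)" by (rule basic_polytope_subset)
qed (simp_all add: subspace_coord_space assms)

text \<open>One induction for all three properties: finiteness and dimension at the next level rest
  on the symmetric pair at the present one.\<close>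

lemma basic_polytope_invariants:
  "double_pair a n \<and> finite {F. F face_of basic_polytope a n} \<and> has_aff_dim (basic_polytope a n) (2 ^ n)"
proof (induction n)
  case 0
  let ?e = "\<lambda>t::real. Poly_Mapping.single (0::nat) t"
  note lin = linear_single[of "0::nat"] and inj = inj_single[of "0::nat"] and P = basic_polytope_0
  have pair: "double_pair a 0"
  proof (rule double_pairI)
    show "convex (basic_polytope a 0)" unfolding P by (rule convex_linear_image[OF lin]) simp
    show "0 \<in> basic_polytope a 0" by (auto simp: basic_polytope.simps intro: exI[of _ 0])
    show "- x \<in> basic_polytope a 0" if "x \<in> basic_polytope a 0" for x
      using that by (auto simp: basic_polytope.simps simp flip: single_uminus intro: exI[of _ "- t" for t])
  qed
  have "finite {F. F face_of basic_polytope a 0}"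
    unfolding P faces_of_linear_image[OF lin inj]
    by (intro finite_imageI finite_polytope_faces) (simp add: polytope_interval flip: box_real)
  moreover have "has_aff_dim (basic_polytope a 0) (2 ^ 0)"
  proof -
    \<comment> \<open>The segment contains the origin, so its affine dimension is the linear
      dimension of the interval, with basis \<open>{1}\<close>.\<close>
    have "span {1} = (UNIV :: real set)" by (auto simp: span_singleton)
    then have "span {1} = span {- 1..1::real}" using span_mono[of "{1}" "{- 1..1::real}"] by auto
    then have "dim {- 1..1::real} = card {1::real}" by (rule dim_eq_card) simp
    then have "dim (basic_polytope a 0) = 1" unfolding P using dim_linear_inj_image[OF lin inj] by simp
    moreover have "0 \<in> basic_polytope a 0" by (auto simp: basic_polytope.simps intro: exI[of _ 0])
    moreover have "basic_polytope a 0 \<subseteq> span ((\<lambda>i. Poly_Mapping.single i 1) ` {..<1})"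
      using basic_polytope_subset[of a 0] coord_space_subset_span[of 1] by simp
    ultimately show ?thesis by (subst has_aff_dim_iff_dim[of _ _ 0]) simp_all
  qed
  ultimately show ?case using pair by simp
next
  case (Suc n)
  then interpret symmetric_pair "coord_space (2 ^ n)" "shift_coords (2 ^ n) ` coord_space (2 ^ n)"
    "basic_polytope a n" "shift_coords (2 ^ n) ` basic_polytope a n"
    "(\<lambda>i. Poly_Mapping.single i 1) ` {..<2 ^ Suc n}" by simp
  have fin: "finite {F. F face_of basic_polytope a n}" "finite {F. F face_of shift_coords (2 ^ n) ` basic_polytope a n}"
    using Suc by (simp_all add: faces_of_linear_image linear_shift_coords inj_shift_coords)
  have d: "has_aff_dim (basic_polytope a n) (2 ^ n)" "has_aff_dim (shift_coords (2 ^ n) ` basic_polytope a n) (2 ^ n)"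
    using Suc by (simp_all add: has_aff_dim_shift_coords[OF basic_polytope_subset])
  show ?case
  proof (cases "Suc n \<in> beatty_set a")
    case True
    have pair: "double_pair a (Suc n)"
    proof (rule double_pairI; unfold basic_polytope_product[OF True])
      show "convex (basic_polytope a n + shift_coords (2 ^ n) ` basic_polytope a n)"
        by (intro convex_set_plus convex_PQ)
      show "0 \<in> basic_polytope a n + shift_coords (2 ^ n) ` basic_polytope a n"
        using set_plus_intro[OF zero] by simp
      show "- x \<in> basic_polytope a n + shift_coords (2 ^ n) ` basic_polytope a n"
        if x: "x \<in> basic_polytope a n + shift_coords (2 ^ n) ` basic_polytope a n" for x
      proof -
        obtain y z where "x = y + z" "y \<in> basic_polytope a n" "z \<in> shift_coords (2 ^ n) ` basic_polytope a n"
          using x by (rule set_plus_elim)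
        then have "- y + - z \<in> basic_polytope a n + shift_coords (2 ^ n) ` basic_polytope a n"
          by (intro set_plus_intro sym)
        then show ?thesis using \<open>x = y + z\<close> by (simp add: add.commute)
      qed
    qed
    then show ?thesis
      using finite_faces_plus[OF fin] has_aff_dim_plus[OF subset d, of "2 ^ Suc n"]
      by (simp add: basic_polytope_product[OF True])
  next
    case False
    have pair: "double_pair a (Suc n)"
    proof (rule double_pairI; unfold basic_polytope_free_sum[OF False])
      show "0 \<in> convex hull (basic_polytope a n \<union> shift_coords (2 ^ n) ` basic_polytope a n)"
        using zero by (simp add: hull_inc)
    qed (simp_all add: symmetric_hull_union)
    then show ?thesis
      using finite_faces_hull_union[OF fin] has_aff_dim_hull_union_whole[OF d, of "2 ^ Suc n"]
      by (simp add: basic_polytope_free_sum[OF False])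
  qed
qed

section \<open>Recursions for the face numbers of the basic polytopes\<close>

abbreviation face_count :: "real \<Rightarrow> nat \<Rightarrow> nat \<Rightarrow> nat" where
  "face_count a n k \<equiv> num_faces k (basic_polytope a n)"

lemma
  shows double_pair_basic_polytope: "double_pair a n"
    and finite_faces_basic_polytope: "finite {F. F face_of basic_polytope a n}"
    and finite_faces_shifted_basic_polytope: "finite {F. F face_of shift_coords (2 ^ n) ` basic_polytope a n}"
    and has_aff_dim_basic_polytope: "has_aff_dim (basic_polytope a n) (2 ^ n)"
    and has_aff_dim_shifted_basic_polytope: "has_aff_dim (shift_coords (2 ^ n) ` basic_polytope a n) (2 ^ n)"
    and num_faces_shifted_basic_polytope: "num_faces k (shift_coords (2 ^ n) ` basic_polytope a n) = face_count a n k"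
  using basic_polytope_invariants[where a = a and n = n]
  by (simp_all add: faces_of_linear_image linear_shift_coords inj_shift_coords
      has_aff_dim_shift_coords[OF basic_polytope_subset] num_faces_shift_coords[OF basic_polytope_subset])

lemma face_count_product_le:
  assumes "Suc n \<in> beatty_set a"
  shows "face_count a (Suc n) k \<le> (\<Sum>i\<le>k. face_count a n i * face_count a n (k - i))"
  using symmetric_pair.num_faces_plus_le[OF double_pair_basic_polytope[where a = a and n = n] finite_faces_basic_polytope
      finite_faces_shifted_basic_polytope]
  unfolding basic_polytope_product[OF assms] num_faces_shifted_basic_polytope .

lemma face_count_product_ge:
  assumes "Suc n \<in> beatty_set a"
  shows "face_count a n i * face_count a n j \<le> face_count a (Suc n) (i + j)"
  using symmetric_pair.num_faces_plus_ge[OF double_pair_basic_polytope[where a = a and n = n] finite_faces_basic_polytope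
      finite_faces_shifted_basic_polytope]
  unfolding basic_polytope_product[OF assms] num_faces_shifted_basic_polytope .

lemma face_count_free_sum_le:
  assumes "Suc n \<notin> beatty_set a"
  shows "face_count a (Suc n) k
    \<le> 1 + 2 * face_count a n k + (\<Sum>i<k. face_count a n i * face_count a n (k - 1 - i))"
  using symmetric_pair.num_faces_hull_union_le[OF double_pair_basic_polytope[where a = a and n = n] finite_faces_basic_polytope
      finite_faces_shifted_basic_polytope]
  unfolding basic_polytope_free_sum[OF assms] num_faces_shifted_basic_polytope mult_2 add.assoc .

lemma face_count_free_sum_ge:
  assumes "Suc n \<notin> beatty_set a" "i < 2 ^ n" "j < 2 ^ n"
  shows "face_count a n i * face_count a n j \<le> face_count a (Suc n) (Suc (i + j))"
  using symmetric_pair.num_faces_hull_union_ge[OF double_pair_basic_polytope[where a = a and n = n] finite_faces_basic_polytope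
      finite_faces_shifted_basic_polytope has_aff_dim_basic_polytope has_aff_dim_shifted_basic_polytope assms(2,3)]
  unfolding basic_polytope_free_sum[OF assms(1)] num_faces_shifted_basic_polytope .

lemma face_count_free_sum_ge_same:
  assumes "Suc n \<notin> beatty_set a" "i < 2 ^ n"
  shows "face_count a n i \<le> face_count a (Suc n) i"
  using symmetric_pair.num_faces_hull_union_ge_left[OF double_pair_basic_polytope[where a = a and n = n] finite_faces_basic_polytope
      finite_faces_shifted_basic_polytope has_aff_dim_basic_polytope assms(2)]
  unfolding basic_polytope_free_sum[OF assms(1)] .

lemma face_count_top: "1 \<le> face_count a n (2 ^ n)"
proof -
  have "basic_polytope a n face_of basic_polytope a n"
    using symmetric_pair.convex_PQ(1)[OF double_pair_basic_polytope] by (rule face_of_refl)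
  then have "{basic_polytope a n} \<subseteq> {F. F face_of basic_polytope a n \<and> has_aff_dim F (2 ^ n)}"
    using has_aff_dim_basic_polytope by simp
  then have "card {basic_polytope a n} \<le> face_count a n (2 ^ n)"
    unfolding num_faces_def by (rule card_mono[rotated]) (use finite_faces_basic_polytope in simp)
  then show ?thesis by simp
qed

lemma face_count_0_0: "2 \<le> face_count a 0 0"
proof -
  let ?e = "\<lambda>t::real. Poly_Mapping.single (0::nat) t"
  note lin = linear_single[of "0::nat"] and inj = inj_single[of "0::nat"] and P = basic_polytope_0
  have seg: "{t} face_of {- 1..1}" if "t \<in> {- 1, 1}" for t :: real
    using that extreme_point_of_segment[of t "-1" 1]
    by (auto simp: face_of_singleton closed_segment_eq_real_ivl)
  have "{?e t} face_of basic_polytope a 0" if "t \<in> {- 1, 1}" for t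
    using face_of_linear_image[OF lin inj, of "{t}" "{- 1..1}"] seg[OF that] unfolding P by simp
  moreover have "has_aff_dim {x} 0" for x :: "nat \<Rightarrow>\<^sub>0 real"
    unfolding has_aff_dim_def by (intro exI[of _ "{x}"]) simp
  ultimately have "{{?e (- 1)}, {?e 1}} \<subseteq> {F. F face_of basic_polytope a 0 \<and> has_aff_dim F 0}"
    by (simp del: single_one)
  then have "card {{?e (- 1)}, {?e 1}} \<le> face_count a 0 0"
    unfolding num_faces_def by (rule card_mono[rotated]) (use finite_faces_basic_polytope in simp)
  moreover have "?e (- 1) \<noteq> ?e 1" using injD[OF inj, of "- 1" 1] by (auto simp del: single_one)
  ultimately show ?thesis by (simp del: single_one)
qed

lemma face_count_ge_2: "k < 2 ^ n \<Longrightarrow> 2 \<le> face_count a n k"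
proof (induction n arbitrary: k)
  case 0
  then show ?case using face_count_0_0 by simp
next
  case (Suc n)
  show ?case
  proof (cases "Suc n \<in> beatty_set a")
    case True
    show ?thesis
    proof (cases "k < 2 ^ n")
      case k: True
      have "2 * 2 \<le> face_count a n k * face_count a n 0"
        by (intro mult_le_mono Suc.IH k) simp
      then show ?thesis using face_count_product_ge[OF True, of k 0] by simp
    next
      case False
      then have k: "k = (k - 2 ^ n) + 2 ^ n" "k - 2 ^ n < 2 ^ n" using Suc.prems by auto
      have "2 * 1 \<le> face_count a n (k - 2 ^ n) * face_count a n (2 ^ n)"
        by (intro mult_le_mono Suc.IH k(2) face_count_top)
      then show ?thesis using face_count_product_ge[OF True, of "k - 2 ^ n" "2 ^ n"] k(1) by simp
    qed
  next
    case sum: False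
    show ?thesis
    proof (cases "k < 2 ^ n")
      case True
      then show ?thesis using face_count_free_sum_ge_same[OF sum True] Suc.IH[OF True] by linarith
    next
      case False
      \<comment> \<open>A join requires proper faces, so the second copy contributes a facet, of
        dimension \<open>2 ^ n - 1\<close>; joining restores the missing one.\<close>
      have k: "k = Suc ((k - 2 ^ n) + (2 ^ n - 1))" "k - 2 ^ n < 2 ^ n" "2 ^ n - 1 < (2 ^ n :: nat)"
        using False Suc.prems by (simp_all add: Suc_diff_1)
      have "2 * 2 \<le> face_count a n (k - 2 ^ n) * face_count a n (2 ^ n - 1)"
        by (intro mult_le_mono Suc.IH k(2,3))
      then show ?thesis using face_count_free_sum_ge[OF sum k(2,3)] k(1) by simp
    qed
  qed
qed

lemma face_count_pos: "k \<le> 2 ^ n \<Longrightarrow> 1 \<le> face_count a n k"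
  using face_count_ge_2[of k n a] face_count_top[where a = a and n = n] by (cases "k = 2 ^ n") auto

section \<open>Lower bound\<close>

definition prod_count :: "real \<Rightarrow> nat \<Rightarrow> nat" where
  "prod_count a n = (\<Sum>i<n. of_bool (Suc i \<in> beatty_set a))"

lemma prod_count_0: "prod_count a 0 = 0"
  and prod_count_Suc: "prod_count a (Suc n) = prod_count a n + of_bool (Suc n \<in> beatty_set a)"
  by (simp_all add: prod_count_def)

text \<open>A product multiplies the vertex numbers of its factors, and a free sum keeps the
  vertices of one copy.\<close>

lemma vertex_count_ge: "2 ^ (2 ^ prod_count a l) \<le> face_count a l 0"
proof (induction l)
  case 0
  then show ?case using face_count_0_0 by (simp add: prod_count_0)
next
  case (Suc l)
  show ?case
  proof (cases "Suc l \<in> beatty_set a")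
    case True
    have "2 ^ (2 ^ prod_count a (Suc l)) = 2 ^ (2 ^ prod_count a l) * (2 ^ (2 ^ prod_count a l) :: nat)"
      by (simp add: prod_count_Suc True mult_2 flip: power_add)
    also have "\<dots> \<le> face_count a l 0 * face_count a l 0" by (intro mult_le_mono Suc)
    also have "\<dots> \<le> face_count a (Suc l) 0" using face_count_product_ge[OF True, of 0 0] by simp
    finally show ?thesis .
  next
    case False
    then show ?thesis
      using Suc face_count_free_sum_ge_same[OF False, of 0] by (simp add: prod_count_Suc)
  qed
qed

text \<open>Combining faces of equal dimension \<open>D\<close> from both halves squares the count
  and yields dimension \<open>D + D\<close> or \<open>Suc (D + D)\<close>; both stay below
  \<open>2 ^ Suc m\<close> when \<open>D < 2 ^ m\<close>.\<close>

lemma face_count_ge_vertex_power: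
  "\<exists>D<2 ^ m. face_count a l 0 ^ (2 ^ m) \<le> face_count a (l + m) D"
proof (induction m)
  case 0
  show ?case by simp
next
  case (Suc m)
  then obtain D where D: "D < 2 ^ m" "face_count a l 0 ^ (2 ^ m) \<le> face_count a (l + m) D" by blast
  have "face_count a l 0 ^ (2 ^ Suc m) = face_count a l 0 ^ (2 ^ m) * face_count a l 0 ^ (2 ^ m)"
    by (simp add: mult_2 power_add)
  also have "\<dots> \<le> face_count a (l + m) D * face_count a (l + m) D"
    by (intro mult_le_mono D(2))
  finally have le: "face_count a l 0 ^ (2 ^ Suc m) \<le> face_count a (l + m) D * face_count a (l + m) D" .
  show ?case
  proof (cases "Suc (l + m) \<in> beatty_set a")
    case True
    then show ?thesis
      using le face_count_product_ge[OF True, of D D] D(1) by (intro exI[of _ "D + D"]) simp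
  next
    case False
    \<comment> \<open>The faces to be joined must be proper at level \<open>l + m\<close>.\<close>
    have "(2::nat) ^ m \<le> 2 ^ (l + m)" by simp
    then have "D < 2 ^ (l + m)" using D(1) by linarith
    then show ?thesis
      using le face_count_free_sum_ge[OF False, of D D] D(1) by (intro exI[of _ "Suc (D + D)"]) simp
  qed
qed

text \<open>The dimension \<open>D\<close> above is not under control; the second half of the polytope supplies
  the missing dimensions.\<close>

lemma face_count_Suc_ge:
  assumes "D < k" "k \<le> 2 ^ n"
  shows "face_count a n D \<le> face_count a (Suc n) k"
proof (cases "Suc n \<in> beatty_set a")
  case True
  have "face_count a n D * 1 \<le> face_count a n D * face_count a n (k - D)"
    using assms by (intro mult_le_mono face_count_pos) simp_all
  also have "\<dots> \<le> face_count a (Suc n) k"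
    using face_count_product_ge[OF True, of D "k - D"] assms by simp
  finally show ?thesis by simp
next
  case False
  have "face_count a n D * 1 \<le> face_count a n D * face_count a n (k - 1 - D)"
    using assms by (intro mult_le_mono face_count_pos) simp_all
  also have "\<dots> \<le> face_count a (Suc n) (Suc (D + (k - 1 - D)))"
    using assms by (intro face_count_free_sum_ge[OF False]) auto
  also have "Suc (D + (k - 1 - D)) = k" using assms by simp
  finally show ?thesis by simp
qed

text \<open>The first \<open>l\<close> levels produce vertices, the next \<open>m\<close> select one
  vertex in each of \<open>2 ^ m\<close> copies, and the last level raises the dimension to exactly
  \<open>k\<close>.\<close>

lemma ln_face_count_ge:
  assumes "2 ^ m \<le> k" "k \<le> 2 ^ (l + m)"
  shows "ln 2 * (2 ^ prod_count a l * 2 ^ m) \<le> ln (real (face_count a (Suc (l + m)) k))"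
proof -
  obtain D where D: "D < 2 ^ m" "face_count a l 0 ^ (2 ^ m) \<le> face_count a (l + m) D"
    using face_count_ge_vertex_power by blast
  have "(2::nat) ^ (2 ^ prod_count a l * 2 ^ m) = (2 ^ (2 ^ prod_count a l)) ^ (2 ^ m)"
    by (simp add: power_mult)
  also have "\<dots> \<le> face_count a l 0 ^ (2 ^ m)" by (intro power_mono vertex_count_ge) simp
  also have "\<dots> \<le> face_count a (l + m) D" by (rule D(2))
  also have "\<dots> \<le> face_count a (Suc (l + m)) k" using D(1) assms by (intro face_count_Suc_ge) simp_all
  finally have "real (2 ^ (2 ^ prod_count a l * 2 ^ m)) \<le> real (face_count a (Suc (l + m)) k)"
    by (rule of_nat_mono)
  then have "ln (2 ^ (2 ^ prod_count a l * 2 ^ m)) \<le> ln (real (face_count a (Suc (l + m)) k))"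
    by (subst ln_le_cancel_iff) (auto intro: less_le_trans[of _ "2 ^ (2 ^ prod_count a l * 2 ^ m)"])
  then show ?thesis by (simp add: ln_realpow mult.commute)
qed

section \<open>Upper bound\<close>

text \<open>The exponent \<open>w\<close> in the bound \<open>2 ^ (w * (k + 1))\<close> for the face
  numbers of a level, with \<open>c\<close> valid for the segment. Doubling pays for a product; the
  summand 2 pays for the number of terms in a free sum.\<close>

fun vertex_exponent :: "real \<Rightarrow> nat \<Rightarrow> nat \<Rightarrow> nat" where
  "vertex_exponent a c 0 = c"
| "vertex_exponent a c (Suc n) =
    (if Suc n \<in> beatty_set a then 2 * vertex_exponent a c n else vertex_exponent a c n + 2)"

lemma vertex_exponent_pos: "1 \<le> c \<Longrightarrow> 1 \<le> vertex_exponent a c l"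
  by (induction l) auto

lemma Suc_le_two_power: "Suc k \<le> 2 ^ k"
  by (induction k) auto

text \<open>The quantity \<open>k + 1\<close> is additive under joins, so a free sum leaves
  \<open>w * (k + 1)\<close> unchanged up to the number of terms. Under products the total becomes
  \<open>k + 2\<close>, which doubling \<open>w\<close> absorbs.\<close>

lemma face_count_le_vertex_exponent:
  assumes c: "1 \<le> c" "\<And>k. face_count a 0 k \<le> 2 ^ c"
  shows "face_count a l k \<le> 2 ^ (vertex_exponent a c l * (k + 1))"
proof (induction l arbitrary: k)
  case 0
  have "face_count a 0 k \<le> 2 ^ c" by (rule c(2))
  also have "(2::nat) ^ c \<le> 2 ^ (c * (k + 1))" by (intro power_increasing) auto
  finally show ?case by simp
next
  case (Suc l)
  define w where "w = vertex_exponent a c l"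
  have w: "1 \<le> w" unfolding w_def using c(1) by (rule vertex_exponent_pos)
  have IH: "face_count a l k \<le> 2 ^ (w * (k + 1))" for k using Suc by (simp add: w_def)
  show ?case
  proof (cases "Suc l \<in> beatty_set a")
    case True
    have "face_count a (Suc l) k \<le> (\<Sum>i\<le>k. face_count a l i * face_count a l (k - i))"
      by (rule face_count_product_le[OF True])
    also have "\<dots> \<le> (\<Sum>i\<le>k. 2 ^ (w * (k + 2)))"
    proof (rule sum_mono)
      fix i assume "i \<in> {..k}"
      then have "w * (i + 1) + w * (k - i + 1) = w * (k + 2)" by (simp flip: distrib_left)
      then show "face_count a l i * face_count a l (k - i) \<le> 2 ^ (w * (k + 2))"
        using mult_le_mono[OF IH[of i] IH[of "k - i"]] by (simp only: flip: power_add)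
    qed
    also have "\<dots> = Suc k * 2 ^ (w * (k + 2))" by simp
    also have "\<dots> \<le> 2 ^ k * 2 ^ (w * (k + 2))" by (intro mult_le_mono Suc_le_two_power) simp
    also have "\<dots> \<le> 2 ^ (2 * w * (k + 1))"
    proof -
      \<comment> \<open>With \<open>1 \<le> w\<close>, the exponent \<open>k + w * (k + 2)\<close>
        is at most \<open>2 * w * (k + 1)\<close>.\<close>
      have "k * 1 \<le> k * w" using w by (intro mult_le_mono) simp_all
      then show ?thesis by (auto simp: algebra_simps simp flip: power_add intro!: power_increasing)
    qed
    finally show ?thesis using True by (simp add: w_def)
  next
    case False
    have "face_count a (Suc l) k \<le> 1 + 2 * face_count a l k + (\<Sum>i<k. face_count a l i * face_count a l (k - 1 - i))"
      by (rule face_count_free_sum_le[OF False])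
    also have "(\<Sum>i<k. face_count a l i * face_count a l (k - 1 - i)) \<le> (\<Sum>i<k. 2 ^ (w * (k + 1)))"
    proof (rule sum_mono)
      fix i assume "i \<in> {..<k}"
      then have "(i + 1) + (k - 1 - i + 1) = k + 1" by simp
      then have "w * (i + 1) + w * (k - 1 - i + 1) = w * (k + 1)" by (simp only: flip: distrib_left)
      then show "face_count a l i * face_count a l (k - 1 - i) \<le> 2 ^ (w * (k + 1))"
        using mult_le_mono[OF IH[of i] IH[of "k - 1 - i"]] by (simp only: flip: power_add)
    qed
    \<comment> \<open>The factor \<open>k + 3\<close> counts one for the whole polytope, two for the
      copies and \<open>k\<close> for the joins.\<close>
    also have "1 + 2 * face_count a l k + (\<Sum>i<k. 2 ^ (w * (k + 1))) \<le> (k + 3) * 2 ^ (w * (k + 1))"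
    proof -
      define B :: nat where "B = 2 ^ (w * (k + 1))"
      have "1 \<le> B" "face_count a l k \<le> B" using IH[of k] by (simp_all add: B_def)
      then show ?thesis unfolding B_def[symmetric] by (simp add: algebra_simps)
    qed
    also have "\<dots> \<le> 2 ^ (2 * (k + 1)) * 2 ^ (w * (k + 1))"
    proof -
      have "k + 3 \<le> 2 ^ (k + 2)" using Suc_le_two_power[of "k + 2"] by simp
      also have "\<dots> \<le> 2 ^ (2 * (k + 1))" by (intro power_increasing) auto
      finally show ?thesis by (intro mult_le_mono) simp_all
    qed
    also have "\<dots> = 2 ^ ((w + 2) * (k + 1))" by (simp add: algebra_simps flip: power_add)
    finally show ?thesis using False by (simp add: w_def)
  qed
qed

text \<open>Now the part of the exponent that is constant in \<open>k\<close> doubles at every step,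
  while the coefficient of \<open>k\<close> grows only by one, through the number of convolution
  terms. Since \<open>k\<close> will be of size \<open>2 ^ m\<close>, doubling that coefficient
  would be too costly. The factor 4 on the left makes the induction close.\<close>

lemma face_count_le:
  assumes c: "1 \<le> c" "\<And>k. face_count a 0 k \<le> 2 ^ c"
    and w_def: "w = vertex_exponent a c l"
  shows "4 * face_count a (l + m) k \<le> 2 ^ ((w + 2) * 2 ^ m + (w + m) * k)"
proof (induction m arbitrary: k)
  case 0
  have "4 * face_count a l k \<le> 4 * 2 ^ (w * (k + 1))"
    using face_count_le_vertex_exponent[OF c] by (simp add: w_def)
  also have "\<dots> = 2 ^ ((w + 2) * 2 ^ 0 + (w + 0) * k)"
    by (simp add: algebra_simps power_add)
  finally show ?case by simp
next
  case (Suc m)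
  define Y where "Y = (w + 2) * 2 ^ m"
  define v where "v = w + m"
  have w: "1 \<le> w" unfolding w_def using c(1) by (rule vertex_exponent_pos)
  have "(w + 2) * 1 \<le> Y" unfolding Y_def by (intro mult_le_mono) simp_all
  \<comment> \<open>This gives \<open>8 \<le> 2 ^ Y\<close> and \<open>16 \<le> 2 ^ (2 * Y)\<close>,
    which swallow the extra terms of a free sum.\<close>
  then have Y: "3 \<le> Y" using w by simp
  have IH: "4 * face_count a (l + m) k \<le> 2 ^ (Y + v * k)" for k using Suc by (simp add: Y_def v_def)
  have prod: "16 * (face_count a (l + m) i * face_count a (l + m) j) \<le> 2 ^ (2 * Y + v * k)"
    if "i + j \<le> k" for i j k
  proof -
    have "16 * (face_count a (l + m) i * face_count a (l + m) j)
        = (4 * face_count a (l + m) i) * (4 * face_count a (l + m) j)" by simp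
    also have "\<dots> \<le> 2 ^ (Y + v * i) * 2 ^ (Y + v * j)" by (intro mult_le_mono IH)
    also have "\<dots> = 2 ^ (2 * Y + v * (i + j))" by (simp add: algebra_simps flip: power_add)
    also have "\<dots> \<le> 2 ^ (2 * Y + v * k)"
      using that by (intro power_increasing add_mono mult_le_mono) simp_all
    finally show ?thesis .
  qed
  \<comment> \<open>Two factors 4 on the left become 16. One 4 pays for the number of terms, at most
    \<open>k + 2\<close> and thus at most \<open>4 * 2 ^ k\<close>; the other is kept for the next
    step.\<close>
  have "16 * face_count a (Suc (l + m)) k \<le> 4 * 2 ^ k * 2 ^ (2 * Y + v * k)"
  proof (cases "Suc (l + m) \<in> beatty_set a")
    case True
    have "16 * face_count a (Suc (l + m)) k \<le> (\<Sum>i\<le>k. 16 * (face_count a (l + m) i * face_count a (l + m) (k - i)))"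
      using face_count_product_le[OF True, of k] by (simp flip: sum_distrib_left)
    also have "\<dots> \<le> (\<Sum>i\<le>k. 2 ^ (2 * Y + v * k))" by (intro sum_mono prod) simp
    also have "\<dots> = Suc k * 2 ^ (2 * Y + v * k)" by simp
    also have "\<dots> \<le> 4 * 2 ^ k * 2 ^ (2 * Y + v * k)"
      using Suc_le_two_power[of k] by (intro mult_le_mono) simp_all
    finally show ?thesis .
  next
    case False
    have "16 * face_count a (Suc (l + m)) k \<le> 16 + 8 * (4 * face_count a (l + m) k)
        + (\<Sum>i<k. 16 * (face_count a (l + m) i * face_count a (l + m) (k - 1 - i)))"
      using face_count_free_sum_le[OF False, of k] by (simp flip: sum_distrib_left)
    also have "(\<Sum>i<k. 16 * (face_count a (l + m) i * face_count a (l + m) (k - 1 - i)))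
        \<le> (\<Sum>i<k. 2 ^ (2 * Y + v * k))" by (intro sum_mono prod) auto
    also have "\<dots> = k * 2 ^ (2 * Y + v * k)" by simp
    also have "8 * (4 * face_count a (l + m) k) \<le> 2 ^ Y * 2 ^ (Y + v * k)"
      using power_increasing[OF Y, of "2::nat"] by (intro mult_le_mono IH) simp
    also have "\<dots> = 2 ^ (2 * Y + v * k)" by (simp add: mult_2 flip: power_add)
    also have "(16::nat) \<le> 2 ^ (2 * Y + v * k)"
      using power_increasing[of 4 "2 * Y + v * k" "2::nat"] Y by simp
    finally have "16 * face_count a (Suc (l + m)) k \<le> (k + 2) * 2 ^ (2 * Y + v * k)"
      by (simp add: algebra_simps)
    also have "\<dots> \<le> 4 * 2 ^ k * 2 ^ (2 * Y + v * k)"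
      using Suc_le_two_power[of k] by (intro mult_le_mono) simp_all
    finally show ?thesis .
  qed
  then have "4 * face_count a (Suc (l + m)) k \<le> 2 ^ k * 2 ^ (2 * Y + v * k)" by simp
  also have "\<dots> = 2 ^ ((w + 2) * 2 ^ Suc m + (w + Suc m) * k)"
    by (simp add: Y_def v_def algebra_simps flip: power_add)
  finally show ?case by simp
qed

lemma ln_face_count_le:
  assumes c: "1 \<le> c" "\<And>k. face_count a 0 k \<le> 2 ^ c" and k: "k \<le> 2 ^ (l + m)"
    and w_def: "w = vertex_exponent a c l"
  shows "ln (real (face_count a (l + m) k)) \<le> ln 2 * ((real w + 2) * 2 ^ m + (real w + real m) * real k)"
proof -
  have pos: "1 \<le> face_count a (l + m) k" using k by (rule face_count_pos)
  have "face_count a (l + m) k \<le> 2 ^ ((w + 2) * 2 ^ m + (w + m) * k)"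
    using face_count_le[OF c refl, where l = l and m = m and k = k] by (simp add: w_def)
  then have "real (face_count a (l + m) k) \<le> real (2 ^ ((w + 2) * 2 ^ m + (w + m) * k))"
    by (rule of_nat_mono)
  then have "ln (real (face_count a (l + m) k)) \<le> ln (real (2 ^ ((w + 2) * 2 ^ m + (w + m) * k)))"
    using pos by (subst ln_le_cancel_iff) simp_all
  also have "\<dots> = ln 2 * ((real w + 2) * 2 ^ m + (real w + real m) * real k)"
    by (simp add: ln_realpow algebra_simps)
  finally show ?thesis .
qed

text \<open>Dividing the recursion by \<open>2 ^ prod_count a l\<close> makes product steps neutral
  and turns the summand 2 of a free sum into a term of the series.\<close>

lemma vertex_exponent_le:
  "real (vertex_exponent a c l) \<le> 2 ^ prod_count a l * (real c + 2 * (\<Sum>j<l. 1 / 2 ^ prod_count a (Suc j)))"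
proof (induction l)
  case 0
  then show ?case by (simp add: prod_count_0)
next
  case (Suc l)
  define S where "S = real c + 2 * (\<Sum>j<l. 1 / 2 ^ prod_count a (Suc j))"
  have IH: "real (vertex_exponent a c l) \<le> 2 ^ prod_count a l * S" using Suc by (simp add: S_def)
  have S: "real c + 2 * (\<Sum>j<Suc l. 1 / 2 ^ prod_count a (Suc j)) = S + 2 / 2 ^ prod_count a (Suc l)"
    by (simp add: S_def)
  show ?case
    unfolding S distrib_left
  proof (cases "Suc l \<in> beatty_set a")
    case True
    then have "real (vertex_exponent a c (Suc l)) \<le> 2 ^ prod_count a (Suc l) * S"
      using IH by (simp add: prod_count_Suc)
    then show "real (vertex_exponent a c (Suc l))
        \<le> 2 ^ prod_count a (Suc l) * S + 2 ^ prod_count a (Suc l) * (2 / 2 ^ prod_count a (Suc l))"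
      by simp
  next
    case False
    then show "real (vertex_exponent a c (Suc l))
        \<le> 2 ^ prod_count a (Suc l) * S + 2 ^ prod_count a (Suc l) * (2 / 2 ^ prod_count a (Suc l))"
      using IH by (simp add: prod_count_Suc)
  qed
qed

section \<open>The density of product steps\<close>

text \<open>The equation \<open>\<lfloor>m / a\<rfloor> = n\<close> says that \<open>m\<close> lies
  in the half-open interval from \<open>a * n\<close> to \<open>a * (n + 1)\<close>; an integer lies
  there exactly when the ceiling increases.\<close>

lemma mem_beatty_set_iff:
  assumes a: "0 < a"
  shows "n \<in> beatty_set a \<longleftrightarrow> \<lceil>a * real n\<rceil> < \<lceil>a * real (Suc n)\<rceil>"
proof -
  have "n \<in> beatty_set a \<longleftrightarrow> (\<exists>m::nat. \<lfloor>real m / a\<rfloor> = int n)"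
    using a by (auto simp: beatty_set_def nat_eq_iff2 eq_nat_nat_iff)
  also have "\<dots> \<longleftrightarrow> (\<exists>m::nat. a * real n \<le> real m \<and> real m < a * real (Suc n))"
    using a by (simp add: floor_eq_iff field_simps)
  also have "\<dots> \<longleftrightarrow> (\<exists>m::int. a * real n \<le> real_of_int m \<and> real_of_int m < a * real (Suc n))"
  proof
    assume "\<exists>m::nat. a * real n \<le> real m \<and> real m < a * real (Suc n)"
    then obtain m :: nat where "a * real n \<le> real m" "real m < a * real (Suc n)" by blast
    then show "\<exists>m::int. a * real n \<le> real_of_int m \<and> real_of_int m < a * real (Suc n)"
      by (intro exI[of _ "int m"]) simp
  next
    assume "\<exists>m::int. a * real n \<le> real_of_int m \<and> real_of_int m < a * real (Suc n)"
    then obtain m :: int where m: "a * real n \<le> real_of_int m" "real_of_int m < a * real (Suc n)" by blast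
    have "0 \<le> a * real n" using a by simp
    then have "0 \<le> m" using m(1) by linarith
    then show "\<exists>m::nat. a * real n \<le> real m \<and> real m < a * real (Suc n)"
      using m by (intro exI[of _ "nat m"]) simp
  qed
  also have "\<dots> \<longleftrightarrow> (\<exists>m::int. \<lceil>a * real n\<rceil> \<le> m \<and> m < \<lceil>a * real (Suc n)\<rceil>)"
    by (simp add: ceiling_le_iff less_ceiling_iff)
  also have "\<dots> \<longleftrightarrow> \<lceil>a * real n\<rceil> < \<lceil>a * real (Suc n)\<rceil>"
    by (meson le_less_trans order_refl)
  finally show ?thesis .
qed

text \<open>For \<open>a < 1\<close> the ceiling grows by at most one per step, so the membership
  indicators telescope. The subtracted 1 is the initial value
  \<open>\<lceil>a\<rceil>\<close>.\<close>

lemma prod_count_eq: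
  assumes a: "0 < a" "a < 1"
  shows "int (prod_count a n) = \<lceil>a * real (Suc n)\<rceil> - 1"
proof (induction n)
  case 0
  have "\<lceil>a\<rceil> = 1" using a by (simp add: ceiling_eq_iff)
  then show ?case by (simp add: prod_count_0)
next
  case (Suc n)
  have "a * real (Suc (Suc n)) = a * real (Suc n) + a" by (simp add: algebra_simps)
  then have "\<lceil>a * real (Suc (Suc n))\<rceil> \<le> \<lceil>a * real (Suc n)\<rceil> + 1" "\<lceil>a * real (Suc n)\<rceil> \<le> \<lceil>a * real (Suc (Suc n))\<rceil>"
    using a by linarith+
  then show ?case
    using Suc mem_beatty_set_iff[OF a(1), of "Suc n"] by (auto simp: prod_count_Suc)
qed

lemma prod_count_bounds:
  assumes a: "0 < a" "a < 1"
  shows "a * real (Suc n) - 1 \<le> real (prod_count a n)" "real (prod_count a n) \<le> a * real (Suc n)"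
  using prod_count_eq[OF a, of n] by linarith+

text \<open>Since \<open>prod_count\<close> grows linearly, the series in
  \<open>vertex_exponent_le\<close> is dominated by a geometric one and stays bounded. Free sums
  therefore cost only a constant factor.\<close>

lemma vertex_exponent_bigo:
  assumes a: "0 < a" "a < 1"
  obtains K where "0 < K" "\<forall>l. real (vertex_exponent a c l) \<le> K * 2 powr (a * real (Suc l))"
proof -
  define q where "q = 2 powr (- a)"
  have q: "0 < q" "q < 1" using a by (simp_all add: q_def powr_less_one)
  \<comment> \<open>The factor 2 compensates for the rounding error 1 in
    \<open>prod_count_bounds\<close>.\<close>
  have le: "1 / 2 ^ prod_count a (Suc j) \<le> 2 * q ^ j" for j
  proof -
    have "1 / 2 ^ prod_count a (Suc j) = 2 powr (- real (prod_count a (Suc j)))"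
      by (simp add: powr_minus powr_realpow divide_inverse)
    also have "\<dots> \<le> 2 powr (1 + (- a * real j))"
      using prod_count_bounds(1)[OF a, of "Suc j"] a by (intro powr_mono) (simp_all add: algebra_simps)
    also have "\<dots> = 2 * q ^ j"
      unfolding powr_add by (simp add: q_def powr_powr flip: powr_realpow)
    finally show ?thesis .
  qed
  have sum: "(\<Sum>j<l. 1 / 2 ^ prod_count a (Suc j)) \<le> 2 / (1 - q)" for l
  proof -
    have "(\<Sum>j<l. 1 / 2 ^ prod_count a (Suc j)) \<le> (\<Sum>j<l. 2 * q ^ j)" by (intro sum_mono le)
    also have "\<dots> = 2 * (\<Sum>j<l. q ^ j)" by (simp add: sum_distrib_left)
    also have "(\<Sum>j<l. q ^ j) = (1 - q ^ l) / (1 - q)" using q by (simp add: sum_gp_strict)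
    also have "2 * \<dots> \<le> 2 / (1 - q)" using q by (simp add: divide_right_mono)
    finally show ?thesis .
  qed
  define K where "K = real c + 2 * (2 / (1 - q))"
  show ?thesis
  proof (intro that allI)
    show "0 < K" using q by (simp add: K_def add_nonneg_pos)
    fix l
    have "real (vertex_exponent a c l) \<le> 2 ^ prod_count a l * (real c + 2 * (\<Sum>j<l. 1 / 2 ^ prod_count a (Suc j)))"
      by (rule vertex_exponent_le)
    also have "\<dots> \<le> 2 ^ prod_count a l * K"
      using sum[of l] by (intro mult_left_mono) (simp_all add: K_def)
    also have "2 ^ prod_count a l = 2 powr real (prod_count a l)" by (simp add: powr_realpow)
    also have "\<dots> * K \<le> 2 powr (a * real (Suc l)) * K"
      using prod_count_bounds(2)[OF a] \<open>0 < K\<close> by (intro mult_right_mono powr_mono) simp_all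
    finally show "real (vertex_exponent a c l) \<le> K * 2 powr (a * real (Suc l))"
      by (simp add: mult.commute)
  qed
qed

section \<open>Asymptotics\<close>

text \<open>Each face number of the segment is at most its total number of faces, which yields one
  exponent for all \<open>k\<close>.\<close>

lemma face_count_initial_bound:
  obtains c where "1 \<le> c" "\<forall>k. face_count a 0 k \<le> 2 ^ c"
proof
  define c where "c = Suc (card {F. F face_of basic_polytope a 0})"
  show "1 \<le> c" by (simp add: c_def)
  have "face_count a 0 k \<le> 2 ^ c" for k
  proof -
    have "face_count a 0 k \<le> card {F. F face_of basic_polytope a 0}"
      unfolding num_faces_def by (rule card_mono[OF finite_faces_basic_polytope]) auto
    also have "\<dots> \<le> 2 ^ c" using Suc_le_two_power[of c] by (simp add: c_def)
    finally show ?thesis .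
  qed
  then show "\<forall>k. face_count a 0 k \<le> 2 ^ c" ..
qed

lemma two_power_floor_le:
  fixes \<delta> :: real
  assumes "0 < \<delta>"
  shows "2 ^ nat \<lfloor>\<delta> * real n\<rfloor> \<le> 2 powr (\<delta> * real n)"
    and "real (nat \<lfloor>\<delta> * real n\<rfloor>) \<le> \<delta> * real n" "\<delta> * real n - 1 \<le> real (nat \<lfloor>\<delta> * real n\<rfloor>)"
proof -
  have "0 \<le> \<delta> * real n" using assms by simp
  then show *: "real (nat \<lfloor>\<delta> * real n\<rfloor>) \<le> \<delta> * real n" "\<delta> * real n - 1 \<le> real (nat \<lfloor>\<delta> * real n\<rfloor>)"
    by linarith+
  then show "2 ^ nat \<lfloor>\<delta> * real n\<rfloor> \<le> 2 powr (\<delta> * real n)"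
    by (simp_all flip: powr_realpow)
qed

lemma two_power_powr: "(2 ^ n :: real) powr x = 2 powr (real n * x)"
  by (simp add: powr_powr flip: powr_realpow)

lemma ln_face_count_lower:
  fixes a \<delta> :: real
  assumes a: "0 < a" "a < 1" and \<delta>: "0 < \<delta>" "\<delta> < 1"
  obtains c where "0 < c" "\<forall>\<^sub>F n in sequentially. c * 2 powr (real n * (a + \<delta> * (1 - a)))
    \<le> ln (real (face_count a n (nat \<lfloor>2 powr (\<delta> * real n)\<rfloor>)))"
proof
  \<comment> \<open>The 4 is \<open>2 ^ 2\<close>: one unit of exponent is lost in
    \<open>prod_count_bounds\<close>, another in rounding \<open>m\<close>.\<close>
  show "0 < ln 2 / (4::real)" by simp
  \<comment> \<open>From this point on \<open>\<delta> * n \<le> n - 1\<close>, which leaves room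
    for the level that adjusts the dimension.\<close>
  have "\<forall>\<^sub>F n in sequentially. 1 / (1 - \<delta>) \<le> real n"
    using filterlim_real_sequentially unfolding filterlim_at_top by blast
  then show "\<forall>\<^sub>F n in sequentially. ln 2 / 4 * 2 powr (real n * (a + \<delta> * (1 - a)))
    \<le> ln (real (face_count a n (nat \<lfloor>2 powr (\<delta> * real n)\<rfloor>)))"
  proof eventually_elim
    case (elim n)
    define m where "m = nat \<lfloor>\<delta> * real n\<rfloor>"
    \<comment> \<open>One of the \<open>n\<close> levels is reserved for reaching dimension
      \<open>k\<close>.\<close>
    define l where "l = n - 1 - m"
    define k where "k = nat \<lfloor>2 powr (\<delta> * real n)\<rfloor>"
    note m = two_power_floor_le[OF \<delta>(1), of n, folded m_def]
    have n1: "\<delta> * real n \<le> real n - 1" using elim \<delta> by (simp add: field_simps)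
    then have mn: "real m \<le> real n - 1" using m(2) by linarith
    then have n: "n = Suc (l + m)" by (simp add: l_def)
    have k_le: "real k \<le> 2 powr (\<delta> * real n)" unfolding k_def by simp
    have "2 powr (\<delta> * real n) \<le> 2 powr (real n - 1)" using n1 by (intro powr_mono) simp_all
    with k_le have "real k \<le> 2 powr (real n - 1)" by (rule order_trans)
    also have "\<dots> = real (2 ^ (l + m))" unfolding n by (simp flip: powr_realpow)
    finally have k: "k \<le> 2 ^ (l + m)" by (simp only: of_nat_le_iff)
    have "real_of_int (2 ^ m) \<le> 2 powr (\<delta> * real n)" using m(1) by simp
    then have "2 ^ m \<le> \<lfloor>2 powr (\<delta> * real n)\<rfloor>" by (simp only: le_floor_iff)
    then have mk: "2 ^ m \<le> k" unfolding k_def by (simp add: le_nat_iff)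
    have "a * real (Suc l) - 1 \<le> real (prod_count a l)" by (rule prod_count_bounds(1)[OF a])
    moreover have "a * (real n - \<delta> * real n) \<le> a * real (Suc l)"
      using a m(2) n by (intro mult_left_mono) simp_all
    ultimately have "real n * (a + \<delta> * (1 - a)) - 2 \<le> real (prod_count a l) + real m"
      using m(3) by (simp add: algebra_simps)
    then have "2 powr (real n * (a + \<delta> * (1 - a)) - 2) \<le> 2 powr (real (prod_count a l) + real m)"
      by (intro powr_mono) simp_all
    then have "2 powr (real n * (a + \<delta> * (1 - a))) / 4 \<le> 2 ^ prod_count a l * 2 ^ m"
      by (simp add: powr_diff powr_add powr_realpow)
    then have "ln 2 * (2 powr (real n * (a + \<delta> * (1 - a))) / 4) \<le> ln 2 * (2 ^ prod_count a l * 2 ^ m)"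
      by (intro mult_left_mono) simp_all
    also have "\<dots> \<le> ln (real (face_count a (Suc (l + m)) k))" by (rule ln_face_count_ge[OF mk k])
    finally show ?case unfolding n[symmetric] k_def by simp
  qed
qed

lemma ln_face_count_upper:
  fixes a \<delta> :: real
  assumes a: "0 < a" "a < 1" and \<delta>: "0 < \<delta>" "\<delta> < 1"
  obtains C where "0 < C" "\<forall>n. ln (real (face_count a n (nat \<lfloor>2 powr (\<delta> * real n)\<rfloor>)))
    \<le> C * 2 powr (real n * (a + \<delta> * (1 - a)))"
proof -
  obtain c where c: "1 \<le> c" "\<forall>k. face_count a 0 k \<le> 2 ^ c" by (rule face_count_initial_bound)
  obtain K where K: "0 < K" "\<forall>l. real (vertex_exponent a c l) \<le> K * 2 powr (a * real (Suc l))"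
    by (rule vertex_exponent_bigo[OF a, where c = c])
  define b where "b = a * (1 - \<delta>)"
  have b: "0 < b" using a \<delta> by (simp add: b_def)
  \<comment> \<open>The term with \<open>K\<close> is doubled because \<open>w\<close> multiplies
    both \<open>2 ^ m\<close> and \<open>k\<close>; \<open>2 powr (2 * a)\<close> covers the
    roundings in \<open>Suc l\<close>. The 2 stems from \<open>w + 2\<close>, and the last term
    bounds \<open>m\<close>.\<close>
  define C where "C = ln 2 * (2 * (K * 2 powr (2 * a)) + 2 + 1 / (b * ln 2))"
  show ?thesis
  proof (intro that allI)
    show "0 < C" using K(1) b by (auto simp: C_def intro!: mult_pos_pos add_pos_pos)
    fix n
    define m where "m = nat \<lfloor>\<delta> * real n\<rfloor>"
    define l where "l = n - m"
    define k where "k = nat \<lfloor>2 powr (\<delta> * real n)\<rfloor>"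
    define w where "w = vertex_exponent a c l"
    \<comment> \<open>The target splits as \<open>G * H\<close>: \<open>G\<close> is the order of
      the exponent \<open>w\<close> at level \<open>l\<close>, and \<open>H\<close> that of the
      number of copies and of \<open>k\<close>.\<close>
    define G where "G = 2 powr (b * real n)"
    define H where "H = 2 powr (\<delta> * real n)"
    note m = two_power_floor_le[OF \<delta>(1), of n, folded m_def]
    have dn: "\<delta> * real n \<le> real n" using \<delta> by (simp add: mult_left_le_one_le)
    then have mn: "real m \<le> real n" using m(2) by linarith
    then have n: "n = l + m" by (simp add: l_def)
    have k_le: "real k \<le> H" unfolding k_def H_def by simp
    also have "H \<le> 2 powr real n" unfolding H_def using dn by (intro powr_mono) simp_all
    also have "\<dots> = real (2 ^ (l + m))" unfolding n[symmetric] by (simp add: powr_realpow)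
    finally have k: "k \<le> 2 ^ (l + m)" by (simp only: of_nat_le_iff)
    have G1: "1 \<le> G" unfolding G_def using b by (simp add: ge_one_powr_ge_zero)
    have "real (Suc l) \<le> (1 - \<delta>) * real n + 2" using m(3) n by (simp add: algebra_simps)
    then have "a * real (Suc l) \<le> a * ((1 - \<delta>) * real n + 2)" using a by (intro mult_left_mono) simp_all
    then have "a * real (Suc l) \<le> b * real n + 2 * a" by (simp add: b_def algebra_simps)
    then have "2 powr (a * real (Suc l)) \<le> G * 2 powr (2 * a)"
      unfolding G_def powr_add[symmetric] by (intro powr_mono) simp_all
    then have "K * 2 powr (a * real (Suc l)) \<le> K * (G * 2 powr (2 * a))"
      using K(1) by (intro mult_left_mono) simp_all
    then have w: "real w \<le> K * 2 powr (2 * a) * G"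
      using K(2)[rule_format, of l] by (simp add: w_def algebra_simps)
    \<comment> \<open>The linear term \<open>m\<close> is absorbed into the exponential
      \<open>G\<close> by \<open>x \<le> exp x\<close>.\<close>
    have "b * ln 2 * real n \<le> exp (b * ln 2 * real n)"
      using exp_ge_add_one_self[of "b * ln 2 * real n"] by linarith
    also have "\<dots> = G" by (simp add: G_def powr_def algebra_simps)
    finally have "real n \<le> 1 / (b * ln 2) * G" using b by (simp add: field_simps)
    then have m_le: "real m \<le> 1 / (b * ln 2) * G" using mn by linarith
    have mH: "2 ^ m \<le> H" using m(1) by (simp add: H_def)
    have "(real w + 2) * 2 ^ m + (real w + real m) * real k \<le> (real w + 2) * H + (real w + real m) * H"
      using mH k_le by (intro add_mono mult_left_mono) simp_all
    also have "\<dots> = (2 * real w + 2 + real m) * H" by (simp add: algebra_simps)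
    also have "\<dots> \<le> (2 * (K * 2 powr (2 * a) * G) + 2 * G + 1 / (b * ln 2) * G) * H"
      using w m_le G1 by (intro mult_right_mono add_mono) (simp_all add: H_def)
    also have "\<dots> = (2 * (K * 2 powr (2 * a)) + 2 + 1 / (b * ln 2)) * (G * H)"
      by (simp add: algebra_simps)
    also have "G * H = 2 powr (real n * (a + \<delta> * (1 - a)))"
      unfolding G_def H_def powr_add[symmetric] by (simp add: b_def algebra_simps)
    finally have bound: "ln 2 * ((real w + 2) * 2 ^ m + (real w + real m) * real k)
        \<le> ln 2 * ((2 * (K * 2 powr (2 * a)) + 2 + 1 / (b * ln 2)) * 2 powr (real n * (a + \<delta> * (1 - a))))"
      by (intro mult_left_mono) simp_all
    have "ln (real (face_count a n k)) \<le> ln 2 * ((real w + 2) * 2 ^ m + (real w + real m) * real k)"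
      using ln_face_count_le[OF c(1) c(2)[rule_format] k w_def] unfolding n[symmetric] .
    also note bound
    finally have "ln (real (face_count a n k)) \<le> C * 2 powr (real n * (a + \<delta> * (1 - a)))"
      by (simp only: C_def mult.assoc)
    then show "ln (real (face_count a n (nat \<lfloor>2 powr (\<delta> * real n)\<rfloor>)))
        \<le> C * 2 powr (real n * (a + \<delta> * (1 - a)))" unfolding k_def .
  qed
qed

text \<open>A positive logarithm is what allows it to be written as a power of \<open>d\<close>.
  With \<open>\<delta> < 1\<close> and \<open>1 \<le> n\<close> the dimension stays below
  \<open>d\<close>, where there are at least two faces; at \<open>n = 0\<close> only the segment
  itself would be counted.\<close>

lemma ln_face_count_pos:
  assumes "\<delta> < 1" "1 \<le> n"
  shows "0 < ln (real (face_count a n (nat \<lfloor>2 powr (\<delta> * real n)\<rfloor>)))"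
proof -
  have "2 powr (\<delta> * real n) < 2 powr real n" using assms by (intro powr_less_mono) simp_all
  also have "\<dots> = real (2 ^ n)" by (simp add: powr_realpow)
  finally have "2 powr (\<delta> * real n) < real (2 ^ n)" .
  with of_nat_floor[OF powr_ge_zero] have "real (nat \<lfloor>2 powr (\<delta> * real n)\<rfloor>) < real (2 ^ n)"
    by (rule le_less_trans)
  then have "nat \<lfloor>2 powr (\<delta> * real n)\<rfloor> < 2 ^ n" by (simp only: of_nat_less_iff)
  then have "2 \<le> face_count a n (nat \<lfloor>2 powr (\<delta> * real n)\<rfloor>)" by (rule face_count_ge_2)
  then show ?thesis by simp
qed

text \<open>Solving for the exponent gives \<open>\<epsilon>\<close>. Bounds up to constant factors
  keep \<open>ln (L n) - ln d * e\<close> bounded, so the error is of order \<open>1 / ln d\<close>,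
  which is below the claimed rate.\<close>

lemma exponent_error_bigo:
  fixes L :: "nat \<Rightarrow> real"
  assumes c: "0 < c" "0 < C" and pos: "\<And>n. 1 \<le> n \<Longrightarrow> 0 < L n"
    and lower: "\<forall>\<^sub>F n in sequentially. c * 2 powr (real n * e) \<le> L n"
    and upper: "\<And>n. L n \<le> C * 2 powr (real n * e)"
  shows "\<exists>\<epsilon> :: nat \<Rightarrow> real. (\<forall>n\<ge>1. L n = 2 powr (real n * (e + \<epsilon> n))) \<and> \<epsilon> \<longlonglongrightarrow> 0 \<and>
    \<epsilon> \<in> O(\<lambda>n. 1 / sqrt (ln (2 ^ n)))"
proof (intro exI conjI allI impI)
  define \<epsilon> where "\<epsilon> = (\<lambda>n. ln (L n) / (real n * ln 2) - e)"
  define M where "M = \<bar>ln c\<bar> + \<bar>ln C\<bar>"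
  show "L n = 2 powr (real n * (e + \<epsilon> n))" if "1 \<le> n" for n
    using that pos[OF that] by (simp add: \<epsilon>_def powr_def)
  have bound: "\<forall>\<^sub>F n in sequentially. \<bar>\<epsilon> n\<bar> \<le> M * (1 / sqrt (ln (2 ^ n)))"
    \<comment> \<open>From \<open>n = 2\<close> on, \<open>x = ln d\<close> is at least 1, so that
      \<open>sqrt x \<le> x\<close>.\<close>
    using lower eventually_ge_at_top[of 2]
  proof eventually_elim
    case (elim n)
    define x where "x = real n * ln 2"
    have n: "1 \<le> n" using elim by simp
    have x1: "1 \<le> x"
    proof -
      have "1 / 2 \<le> ln (2::real)" using ln2_ge_two_thirds by simp
      then have "2 * (1 / 2) \<le> real n * ln 2" using elim(2) by (intro mult_mono) simp_all
      then show ?thesis by (simp add: x_def)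
    qed
    have "ln (c * 2 powr (real n * e)) \<le> ln (L n)"
      using elim(1) c pos[OF n] by (subst ln_le_cancel_iff) simp_all
    then have l: "ln c + x * e \<le> ln (L n)"
      using c by (simp add: ln_mult ln_powr x_def algebra_simps)
    have "ln (L n) \<le> ln (C * 2 powr (real n * e))"
      using upper[of n] c pos[OF n] by (subst ln_le_cancel_iff) simp_all
    then have u: "ln (L n) \<le> ln C + x * e"
      using c by (simp add: ln_mult ln_powr x_def algebra_simps)
    have "\<epsilon> n = (ln (L n) - x * e) / x" using x1 by (simp add: \<epsilon>_def diff_divide_distrib x_def[symmetric])
    then have "\<bar>\<epsilon> n\<bar> = \<bar>ln (L n) - x * e\<bar> / x" using x1 by simp
    also have "\<dots> \<le> M / x" using l u x1 by (intro divide_right_mono) (auto simp: M_def)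
    also have "\<dots> \<le> M / sqrt x"
    proof (intro divide_left_mono)
      have "sqrt x * 1 \<le> sqrt x * sqrt x" using x1 by (intro mult_left_mono) simp_all
      then show "sqrt x \<le> x" using x1 by simp
    qed (use x1 in \<open>simp_all add: M_def\<close>)
    finally show ?case by (simp add: x_def ln_realpow)
  qed
  then show "\<epsilon> \<in> O(\<lambda>n. 1 / sqrt (ln (2 ^ n)))"
    by (intro bigoI[of _ M]) (auto elim!: eventually_mono)
  have "(\<lambda>n::nat. M * (1 / sqrt (ln (2 ^ n)))) \<longlonglongrightarrow> 0"
  proof -
    have "filterlim (\<lambda>n::nat. real n * ln 2) at_top sequentially"
      using filterlim_real_sequentially
      by (rule filterlim_at_top_mult_tendsto_pos[OF tendsto_const, rotated]) simp
    then have "filterlim (\<lambda>n::nat. sqrt (ln (2 ^ n))) at_top sequentially"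
      using filterlim_compose[OF sqrt_at_top] by (simp add: ln_realpow)
    then have "(\<lambda>n::nat. M / sqrt (ln (2 ^ n))) \<longlonglongrightarrow> 0"
      by (intro tendsto_divide_0[OF tendsto_const] filterlim_at_top_imp_at_infinity)
    then show ?thesis by simp
  qed
  then show "\<epsilon> \<longlonglongrightarrow> 0"
    by (rule Lim_null_comparison[rotated]) (use bound in simp)
qed

theorem theorem4:
  fixes a \<delta> :: real
  assumes "0 < a" "a < 1" and "0 < \<delta>" "\<delta> < 1"
  shows
    "(a \<in> \<rat> \<longrightarrow>
       (\<exists>c C. c > 0 \<and> C > 0 \<and>
         (\<forall>\<^sub>F n in sequentially.
            let d = 2 ^ n :: real;
                f = real (num_faces (nat \<lfloor>d powr \<delta>\<rfloor>) (basic_polytope a n))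
            in c * d powr (a + \<delta> * (1 - a)) \<le> ln f \<and> ln f \<le> C * d powr (a + \<delta> * (1 - a)))))
     \<and>
     (a \<notin> \<rat> \<longrightarrow>
       (\<exists>\<epsilon> :: nat \<Rightarrow> real.
         (\<forall>n\<ge>1.
            let d = 2 ^ n :: real;
                f = real (num_faces (nat \<lfloor>d powr \<delta>\<rfloor>) (basic_polytope a n))
            in ln f = d powr (a + \<delta> * (1 - a) + \<epsilon> n)) \<and>
         \<epsilon> \<longlonglongrightarrow> 0 \<and>
         \<epsilon> \<in> O(\<lambda>n. 1 / sqrt (ln (2 ^ n)))))"
proof -
  obtain c where c: "0 < c" "\<forall>\<^sub>F n in sequentially. c * 2 powr (real n * (a + \<delta> * (1 - a)))
      \<le> ln (real (face_count a n (nat \<lfloor>2 powr (\<delta> * real n)\<rfloor>)))"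
    by (rule ln_face_count_lower[OF assms])
  obtain C where C: "0 < C" "\<forall>n. ln (real (face_count a n (nat \<lfloor>2 powr (\<delta> * real n)\<rfloor>)))
      \<le> C * 2 powr (real n * (a + \<delta> * (1 - a)))"
    by (rule ln_face_count_upper[OF assms])
  have conv: "(2 ^ n :: real) powr \<delta> = 2 powr (\<delta> * real n)" for n
    by (simp add: two_power_powr mult.commute)
  \<comment> \<open>Both conjuncts rest on the same two-sided bound: the first states it, the second
    solves it for the exponent.\<close>
  show ?thesis
    unfolding Let_def conv unfolding two_power_powr
  proof (intro conjI impI)
    show "\<exists>c C. c > 0 \<and> C > 0 \<and> (\<forall>\<^sub>F n in sequentially.
        c * 2 powr (real n * (a + \<delta> * (1 - a))) \<le> ln (real (face_count a n (nat \<lfloor>2 powr (\<delta> * real n)\<rfloor>))) \<and>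
        ln (real (face_count a n (nat \<lfloor>2 powr (\<delta> * real n)\<rfloor>))) \<le> C * 2 powr (real n * (a + \<delta> * (1 - a))))"
      using c C by (intro exI[of _ c] exI[of _ C]) (auto elim: eventually_mono)
  qed (rule exponent_error_bigo[OF c(1) C(1) ln_face_count_pos[OF assms(4)] c(2) C(2)[rule_format]])
qed

end
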